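(* There exists an algorithm which, given any Gaussian free field on a finite connected weighted graph with nodes $\{1,\dots,n\}$, edge set $E$ and weights $r_{ij}$ (with $X_1=0$), and any $\alpha>0$, outputs a set $S_\alpha$ such that $\mathrm{err}(S_\alpha)\le\alpha$ and $$|S_\alpha|\ \le\ \Big(1+\ln\Big((n-1)^2\,\frac{R}{r}\Big)\Big)\cdot\min_{\mathrm{err}(S)\le\alpha}|S|,$$ where $r=\min_{i\ne j}r_{ij}$ and $R=\max_{\{i,j\}\in E}r_{ij}$.
   Context: Gaussian free field (GFF): Let $G=(\{1,\dots,n\},E)$ be a finite connected graph, each edge $\{i,j\}\in E$ having a finite weight $r_{ij}=r_{ji}>0$; set $r_{ij}=+\infty$ (so $1/r_{ij}=0$) if $\{i,j\}\notin E$. The GFF is the random vector $\mathbf X=(X_1,\dots,X_n)$ with $X_1=0$ and density $\rho(X_1,\dots,X_n)\propto\exp\big(-\sum_{\{i,j\}\in E}\frac{(X_i-X_j)^2}{2r_{ij}}\big)$. Its Laplacian is $\Lambda[i,i]=\sum_{t\ne i}1/r_{it}$ and $\Lambda[i,j]=-1/r_{ij}$ for $i\neq j$; $(X_2,\dots,X_n)$ is a centered Gaussian with precision (inverse covariance) matrix $\Lambda[\{2,\dots,n\},\{2,\dots,n\}]$. The variable $X_1$ is regarded as always selected for observation, so observation sets $S\subseteq\{1,\dots,n\}$ contain $1$. The average expected squared prediction error is $$\mathrm{err}(S)=\frac1n\sum_{i=1}^n\mathrm{Var}[X_i\mid \mathbf X_S]=\frac1n\mathrm{Tr}\big(\Lambda[\overline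 S,\overline S]^{-1}\big),$$ where $\mathbf X_S$ is the vector of variables indexed by $S$, $\overline S=\{1,\dots,n\}\setminus S$, and $\Lambda[A,B]$ is the submatrix with rows $A$ and columns $B$. The algorithm intended is the standard greedy algorithm for supermodular cover (repeatedly add the element giving the largest decrease of $\mathrm{err}$ until $\mathrm{err}\le\alpha$), which uses polynomially many evaluations of $\mathrm{err}$. *)

theory Defs
  imports "HOL-Probability.Probability"
begin

section \<open>Finite connected weighted graphs on the nodes 1, ..., n\<close>

text \<open>
  Edges are two-element sets of nodes. The weight \<open>r i j\<close> is only meaningful when
  \<open>{i, j} \<in> E\<close>; a pair that is not an edge has weight \<open>+\<infinity>\<close> (conductance 0), so it
  contributes neither to the energy nor to the minimal weight. For \<open>n = 1\<close> there are no edges and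
  the extreme weights below are unspecified.
\<close>

definition weighted_graph ::
  "nat \<Rightarrow> nat set set \<Rightarrow> (nat \<Rightarrow> nat \<Rightarrow> real) \<Rightarrow> bool" where
  "weighted_graph n E r \<longleftrightarrow>
     n \<ge> 1 \<and>
     (\<forall>e\<in>E. \<exists>i\<in>{1..n}. \<exists>j\<in>{1..n}. i \<noteq> j \<and> e = {i, j}) \<and>
     (\<forall>i j. {i, j} \<in> E \<longrightarrow> 0 < r i j \<and> r i j = r j i) \<and>
     (\<forall>i\<in>{1..n}. \<forall>j\<in>{1..n}. (i, j) \<in> {(u, v). {u, v} \<in> E}\<^sup>*)"

definition edge_weights :: "nat set set \<Rightarrow> (nat \<Rightarrow> nat \<Rightarrow> real) \<Rightarrow> real set" where
  "edge_weights E r = {r i j | i j. {i, j} \<in> E}"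

definition min_weight :: "nat set set \<Rightarrow> (nat \<Rightarrow> nat \<Rightarrow> real) \<Rightarrow> real" where
  "min_weight E r = Min (edge_weights E r)"

definition max_weight :: "nat set set \<Rightarrow> (nat \<Rightarrow> nat \<Rightarrow> real) \<Rightarrow> real" where
  "max_weight E r = Max (edge_weights E r)"


section \<open>The Gaussian free field\<close>

text \<open>
  The sample space consists of the values of \<open>X\<^sub>2, \<dots>, X\<^sub>n\<close>; the coordinate \<open>X\<^sub>1\<close> is
  pinned to 0.
\<close>

definition gff_coord :: "nat \<Rightarrow> (nat \<Rightarrow> real) \<Rightarrow> real" where
  "gff_coord i \<omega> = (if i = 1 then 0 else \<omega> i)"

text \<open>Ordering the endpoints makes the sum range over every edge exactly once.\<close>

definition gff_energy ::
  "nat \<Rightarrow> nat set set \<Rightarrow> (nat \<Rightarrow> nat \<Rightarrow> real) \<Rightarrow> (nat \<Rightarrow> real) \<Rightarrow> real" where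
  "gff_energy n E r \<omega> =
     (\<Sum>(i, j) \<in> {(i, j). i \<in> {1..n} \<and> j \<in> {1..n} \<and> i < j \<and> {i, j} \<in> E}.
        (gff_coord i \<omega> - gff_coord j \<omega>)\<^sup>2 / (2 * r i j))"

definition gff_reference :: "nat \<Rightarrow> (nat \<Rightarrow> real) measure" where
  "gff_reference n = (\<Pi>\<^sub>M i\<in>{2..n}. lborel)"

definition gff ::
  "nat \<Rightarrow> nat set set \<Rightarrow> (nat \<Rightarrow> nat \<Rightarrow> real) \<Rightarrow> (nat \<Rightarrow> real) measure" where
  "gff n E r =
     density (gff_reference n)
       (\<lambda>\<omega>. ennreal (exp (- gff_energy n E r \<omega>) /
                      (\<integral>\<omega>'. exp (- gff_energy n E r \<omega>') \<partial>gff_reference n)))"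


section \<open>Prediction error\<close>

definition cond_variance :: "'a measure \<Rightarrow> 'a measure \<Rightarrow> ('a \<Rightarrow> real) \<Rightarrow> 'a \<Rightarrow> real" where
  "cond_variance M F X = real_cond_exp M F (\<lambda>\<omega>. (X \<omega> - real_cond_exp M F X \<omega>)\<^sup>2)"

text \<open>The sigma-algebra generated by the observed variables.\<close>

definition observed :: "'a measure \<Rightarrow> (nat \<Rightarrow> 'a \<Rightarrow> real) \<Rightarrow> nat set \<Rightarrow> 'a measure" where
  "observed M X S =
     vimage_algebra (space M) (\<lambda>\<omega>. \<lambda>i\<in>S. X i \<omega>) (\<Pi>\<^sub>M i\<in>S. borel)"

text \<open>
  A conditional variance is a random variable, determined up to null sets. For a Gaussian
  vector it is almost surely constant; taking the expectation extracts that constant, which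
  is the expected squared error of the optimal prediction.
\<close>

definition err ::
  "nat \<Rightarrow> nat set set \<Rightarrow> (nat \<Rightarrow> nat \<Rightarrow> real) \<Rightarrow> nat set \<Rightarrow> real" where
  "err n E r S =
     (1 / real n) *
     (\<Sum>i = 1..n. \<integral>\<omega>. cond_variance (gff n E r) (observed (gff n E r) gff_coord S)
                          (gff_coord i) \<omega> \<partial>gff n E r)"

definition feasible ::
  "nat \<Rightarrow> nat set set \<Rightarrow> (nat \<Rightarrow> nat \<Rightarrow> real) \<Rightarrow> real \<Rightarrow> nat set \<Rightarrow> bool" where
  "feasible n E r \<alpha> S \<longleftrightarrow> 1 \<in> S \<and> S \<subseteq> {1..n} \<and> err n E r S \<le> \<alpha>"

definition opt_size ::
  "nat \<Rightarrow> nat set set \<Rightarrow> (nat \<Rightarrow> nat \<Rightarrow> real) \<Rightarrow> real \<Rightarrow> nat" where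
  "opt_size n E r \<alpha> = Min (card ` {S. feasible n E r \<alpha> S})"


section \<open>The greedy algorithm\<close>

text \<open>
  An algorithm is a program that reaches the field only by asking for values of a set
  function: it cannot depend on the graph otherwise, and its queries can be counted.
\<close>

datatype query_prog =
    Return "nat set"
  | Query "nat set" "real \<Rightarrow> query_prog"

primrec run :: "(nat set \<Rightarrow> real) \<Rightarrow> query_prog \<Rightarrow> nat set" where
  "run f (Return S) = S"
| "run f (Query A k) = run f (k (f A))"

primrec queries :: "(nat set \<Rightarrow> real) \<Rightarrow> query_prog \<Rightarrow> nat" where
  "queries f (Return S) = 0"
| "queries f (Query A k) = Suc (queries f (k (f A)))"

text \<open>
  \<open>scan S js i v k\<close> looks for the element whose addition to \<open>S\<close> gives the smallest value
  (the largest decrease), where \<open>i\<close> with value \<open>v\<close> is the best element so far and \<open>js\<close> are the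
  candidates still to be tried, and passes the result to \<open>k\<close>. Ties go to the earlier candidate.
\<close>

primrec scan ::
  "nat set \<Rightarrow> nat list \<Rightarrow> nat \<Rightarrow> real \<Rightarrow> (nat \<Rightarrow> real \<Rightarrow> query_prog) \<Rightarrow> query_prog" where
  "scan S [] i v k = k i v"
| "scan S (j # js) i v k =
     Query (insert j S) (\<lambda>w. if w < v then scan S js j w k else scan S js i v k)"

text \<open>
  In \<open>greedy_rounds m \<alpha> S v js\<close>, \<open>m\<close> bounds the number of further rounds, \<open>v\<close> is the value of
  the current set \<open>S\<close>, and \<open>js\<close> lists the elements not yet selected.
\<close>

primrec greedy_rounds ::
  "nat \<Rightarrow> real \<Rightarrow> nat set \<Rightarrow> real \<Rightarrow> nat list \<Rightarrow> query_prog" where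
  "greedy_rounds 0 \<alpha> S v js = Return S"
| "greedy_rounds (Suc m) \<alpha> S v js =
     (if v \<le> \<alpha> then Return S
      else case js of
        [] \<Rightarrow> Return S
      | i # is \<Rightarrow>
          Query (insert i S) (\<lambda>w. scan S is i w
            (\<lambda>j u. greedy_rounds m \<alpha> (insert j S) u (remove1 j js))))"

text \<open>There are \<open>n - 1\<close> elements to add, so \<open>n - 1\<close> rounds never cut the loop short.\<close>

definition greedy_cover :: "nat \<Rightarrow> real \<Rightarrow> query_prog" where
  "greedy_cover n \<alpha> = Query {1} (\<lambda>v. greedy_rounds (n - 1) \<alpha> {1} v [2..<Suc n])"

end

theory Submission
  imports Defs
begin

text \<open>
  Write \<open>m = n - 1\<close>, let \<open>r\<close> and \<open>R\<close> be the extreme weights, and let \<open>f S = n \<cdot> err S\<close>, which is the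
  trace of the Green function of the network killed on \<open>S\<close>. The maximum principle makes \<open>f\<close>
  supermodular, and adding any node decreases \<open>f\<close> by at least \<open>\<delta> = r / m\<close>.

  Let \<open>S\<^sup>*\<close> be optimal with \<open>k + 1\<close> elements, \<open>S\<^sub>t\<close> the greedy set after \<open>t\<close> steps, and
  \<open>a\<^sub>t = f S\<^sub>t - n \<alpha>\<close>. Supermodularity gives
  \<open>f S\<^sub>t - f (S\<^sub>t \<union> S\<^sup>*) \<le> k (a\<^sub>t - a\<^sub>t\<^sub>+\<^sub>1)\<close>. The usual estimate \<open>f (S\<^sub>t \<union> S\<^sup>*) \<le> n \<alpha>\<close> loses a factor
  of order \<open>n\<close> in the logarithm. It can be sharpened, since at least \<open>t - k\<close> elements of \<open>S\<^sub>t\<close> are not in \<open>S\<^sup>*\<close>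
  and each of them contributes \<open>\<delta>\<close>: thus \<open>a\<^sub>t + (t - k) \<delta> \<le> k (a\<^sub>t - a\<^sub>t\<^sub>+\<^sub>1)\<close>, so that
  \<open>a\<^sub>t + (t - 2k) \<delta>\<close> contracts by \<open>1 - 1/k\<close>.

  Initially \<open>a\<^sub>0 \<le> m p R\<close> where \<open>p\<close> is the largest hop distance from node 1. If the number \<open>T\<close> of
  steps is comparable to \<open>p\<close>, the contraction gives the bound. If \<open>p\<close> is much larger than \<open>T\<close>, then
  most levels of the hop distance are never touched; three consecutive levels contain the
  neighbourhood of a node of the middle one, so some unselected node has few neighbours, and
  every greedy step gains a multiple of \<open>p \<delta>\<close>.
\<close>

section \<open>Queries and progress of the greedy algorithm\<close>

text \<open>The value carried along is always that of the current best candidate. One comparison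
  replaces the initial candidate and leaves a shorter scan of the same form, so the induction lets
  \<open>i\<close> vary.\<close>

lemma scan_minimizes:
  "\<exists>j\<in>set (i # js). (\<forall>y\<in>set (i # js). f (insert j S) \<le> f (insert y S)) \<and>
     run f (scan S js i (f (insert i S)) k) = run f (k j (f (insert j S))) \<and>
     queries f (scan S js i (f (insert i S)) k) = length js + queries f (k j (f (insert j S)))"
proof (induction js arbitrary: i)
  case (Cons x js)
  define b where "b = (if f (insert x S) < f (insert i S) then x else i)"
  obtain j where j: "j \<in> set (b # js)" "\<forall>y\<in>set (b # js). f (insert j S) \<le> f (insert y S)"
    "run f (scan S js b (f (insert b S)) k) = run f (k j (f (insert j S)))"
    "queries f (scan S js b (f (insert b S)) k) = length js + queries f (k j (f (insert j S)))"
    using Cons by blast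
  show ?case
  proof (intro bexI conjI)
    show "j \<in> set (i # x # js)"
      using j(1) by (auto simp: b_def split: if_splits)
    show "\<forall>y\<in>set (i # x # js). f (insert j S) \<le> f (insert y S)"
      using j(2) by (auto simp: b_def split: if_splits)
    show "run f (scan S (x # js) i (f (insert i S)) k) = run f (k j (f (insert j S)))"
      using j(3) by (auto simp: b_def split: if_splits)
    show "queries f (scan S (x # js) i (f (insert i S)) k)
        = length (x # js) + queries f (k j (f (insert j S)))"
      using j(4) by (auto simp: b_def split: if_splits)
  qed
qed simp

text \<open>Replaces the program by a chain of sets with the greedy property. A round with
  \<open>l\<close> candidates costs \<open>l\<close> queries, and
  \<open>l + (l - 1)^2 \<le> l^2\<close>. The bound on \<open>length js\<close> ensures that the
  round counter never stops the loop early.\<close>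

lemma greedy_rounds_trace:
  assumes "distinct js" "length js \<le> m" "set js \<inter> S = {}"
  shows "\<exists>s T. s 0 = S \<and> s T = run f (greedy_rounds m \<alpha> S (f S) js) \<and>
    (\<forall>t<T. \<alpha> < f (s t) \<and> (\<exists>x. x \<in> S \<union> set js - s t \<and> s (Suc t) = insert x (s t)) \<and>
       (\<forall>y\<in>S \<union> set js - s t. f (s (Suc t)) \<le> f (insert y (s t)))) \<and>
    (f (s T) \<le> \<alpha> \<or> s T = S \<union> set js) \<and>
    queries f (greedy_rounds m \<alpha> S (f S) js) \<le> (length js)\<^sup>2"
  using assms
proof (induction m arbitrary: S js)
  case 0
  then show ?case
    by (intro exI[of _ "\<lambda>_. S"] exI[of _ 0]) auto
next
  case (Suc m)
  show ?case
  proof (cases "f S \<le> \<alpha> \<or> js = []")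
    case True
    then show ?thesis
      by (intro exI[of _ "\<lambda>_. S"] exI[of _ 0]) auto
  next
    case False
    then obtain i "is" where js: "js = i # is" by (cases js) auto
    let ?k = "\<lambda>j u. greedy_rounds m \<alpha> (insert j S) u (remove1 j js)"
    obtain j where j: "j \<in> set js" "\<forall>y\<in>set js. f (insert j S) \<le> f (insert y S)"
      "run f (scan S is i (f (insert i S)) ?k) = run f (?k j (f (insert j S)))"
      "queries f (scan S is i (f (insert i S)) ?k) = length is + queries f (?k j (f (insert j S)))"
      using scan_minimizes[of i "is" f S ?k] unfolding js by blast
    have len: "length js = Suc (length (remove1 j js))"
      using j(1) length_pos_if_in_set[OF j(1)] by (simp add: length_remove1)
    have ground: "insert j S \<union> set (remove1 j js) = S \<union> set js"
      using j(1) Suc.prems by auto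
    have prems: "distinct (remove1 j js)" "length (remove1 j js) \<le> m"
        "set (remove1 j js) \<inter> insert j S = {}"
      using Suc.prems len by auto
    obtain s T where s: "s 0 = insert j S"
      "s T = run f (?k j (f (insert j S)))"
      "\<forall>t<T. \<alpha> < f (s t) \<and> (\<exists>x. x \<in> S \<union> set js - s t \<and> s (Suc t) = insert x (s t)) \<and>
       (\<forall>y\<in>S \<union> set js - s t. f (s (Suc t)) \<le> f (insert y (s t)))"
      "f (s T) \<le> \<alpha> \<or> s T = S \<union> set js"
      "queries f (?k j (f (insert j S))) \<le> (length (remove1 j js))\<^sup>2"
      using Suc.IH[OF prems, unfolded ground] by blast
    define s' where "s' = case_nat S s"
    have s': "s' 0 = S" "\<And>t. s' (Suc t) = s t"
      by (auto simp: s'_def)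
    have rounds: "greedy_rounds (Suc m) \<alpha> S (f S) js =
        Query (insert i S) (\<lambda>w. scan S is i w ?k)"
      using False js by simp
    have "s' (Suc T) = run f (greedy_rounds (Suc m) \<alpha> S (f S) js)"
      unfolding rounds using s(2) j(3) by (simp add: s')
    moreover have "\<alpha> < f (s' t) \<and> (\<exists>x. x \<in> S \<union> set js - s' t \<and> s' (Suc t) = insert x (s' t)) \<and>
       (\<forall>y\<in>S \<union> set js - s' t. f (s' (Suc t)) \<le> f (insert y (s' t)))" if "t < Suc T" for t
    proof (cases t)
      case 0
      then show ?thesis
        using False j Suc.prems s(1) by (auto simp: s')
    next
      case (Suc t')
      then show ?thesis
        using s(3) that by (simp add: s')
    qed
    moreover have "f (s' (Suc T)) \<le> \<alpha> \<or> s' (Suc T) = S \<union> set js"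
      using s(4) by (simp add: s')
    moreover have "queries f (greedy_rounds (Suc m) \<alpha> S (f S) js) \<le> (length js)\<^sup>2"
    proof -
      have "queries f (greedy_rounds (Suc m) \<alpha> S (f S) js)
          = length js + queries f (?k j (f (insert j S)))"
        unfolding rounds using j(4) by (simp add: js)
      also have "\<dots> \<le> length js + (length (remove1 j js))\<^sup>2"
        using s(5) by simp
      also have "\<dots> \<le> (length js)\<^sup>2"
        unfolding len by (simp add: power2_eq_square)
      finally show ?thesis .
    qed
    ultimately show ?thesis
      using s'(1) by blast
  qed
qed

lemma greedy_cover_trace:
  assumes "1 \<le> n"
  obtains s T where "s 0 = {1}" "s T = run f (greedy_cover n \<alpha>)"
    "\<And>t. t < T \<Longrightarrow> \<alpha> < f (s t)"
    "\<And>t. t < T \<Longrightarrow> \<exists>x. x \<in> {1..n} - s t \<and> s (Suc t) = insert x (s t)"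
    "\<And>t y. t < T \<Longrightarrow> y \<in> {1..n} - s t \<Longrightarrow> f (s (Suc t)) \<le> f (insert y (s t))"
    "f (s T) \<le> \<alpha> \<or> s T = {1..n}"
    "queries f (greedy_cover n \<alpha>) \<le> n\<^sup>2"
proof -
  have ground: "{1} \<union> set [2..<Suc n] = {1..n}"
    using assms by auto
  have js: "distinct [2..<Suc n]" "length [2..<Suc n] \<le> n - 1" "set [2..<Suc n] \<inter> {1} = {}"
    by auto
  obtain s T where s: "s 0 = {1}" "s T = run f (greedy_cover n \<alpha>)"
    "\<forall>t<T. \<alpha> < f (s t) \<and> (\<exists>x. x \<in> {1..n} - s t \<and> s (Suc t) = insert x (s t)) \<and>
       (\<forall>y\<in>{1..n} - s t. f (s (Suc t)) \<le> f (insert y (s t)))"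
    "f (s T) \<le> \<alpha> \<or> s T = {1..n}"
    "queries f (greedy_rounds (n - 1) \<alpha> {1} (f {1}) [2..<Suc n]) \<le> (length [2..<Suc n])\<^sup>2"
    using greedy_rounds_trace[OF js, of f \<alpha>] unfolding ground by (auto simp: greedy_cover_def)
  have "queries f (greedy_cover n \<alpha>) \<le> Suc ((n - 1)\<^sup>2)"
    using s(5) assms by (simp add: greedy_cover_def del: upt_Suc)
  also have "\<dots> \<le> n\<^sup>2"
    using assms by (cases n) (auto simp: power2_eq_square)
  finally show ?thesis
    using that[of s T] s by blast
qed

section \<open>Numerical bounds and the recursion for the number of steps\<close>

lemma linear_le_ln:
  fixes m :: nat
  assumes "2 \<le> m" "m \<le> 18"
  shows "real m - 2 \<le> 6 * ln (real m)"
proof -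
  have e: "exp 1 \<le> (2.72 :: real)"
    using e_less_272 by simp
  have ln_ge: "real b / real c \<le> ln (real a)"
    if "(2.72 :: real) ^ b \<le> real a ^ c" "0 < a" "0 < c" for a b c :: nat
  proof -
    have "exp (real b) = exp 1 ^ b"
      by (simp add: exp_of_nat_mult[symmetric])
    also have "\<dots> \<le> 2.72 ^ b"
      by (intro power_mono e) simp
    also have "\<dots> \<le> real a ^ c"
      by (rule that)
    finally have "real b \<le> ln (real a ^ c)"
      using that by (simp add: ln_ge_iff)
    then show ?thesis
      using that by (simp add: ln_realpow field_simps)
  qed
  have mono: "ln (real a) \<le> ln (real m)" if "a \<le> m" "0 < a" for a
    using that by simp
  \<comment> \<open>The points 2, 4, 10, 15 cut the range so that on each piece the right endpoint
    minus 2 is at most 6 times the bound at the left endpoint. Each bound comes from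
    \<open>2.72 ^ b \<le> a ^ c\<close>.\<close>
  have lns: "2 / 3 \<le> ln (real 2)" "8 / 6 \<le> ln (real 4)" "13 / 6 \<le> ln (real 10)" "16 / 6 \<le> ln (real 15)"
    using ln_ge[of 2 2 3] ln_ge[of 8 4 6] ln_ge[of 13 10 6] ln_ge[of 16 15 6]
    by (simp_all add: power_divide)
  have le: "real m - 2 \<le> 6 * ln (real m)"
    if "a \<le> m" "m \<le> b" "real b - 2 \<le> 6 * ln (real a)" "0 < a" for a b
    using that(2,3) mono[OF that(1,4)] by linarith
  consider "m \<le> 4" | "4 \<le> m" "m \<le> 10" | "10 \<le> m" "m \<le> 15" | "15 \<le> m"
    by linarith
  then show ?thesis
    using le[of 2 4] le[of 4 10] le[of 10 15] le[of 15 18] lns assms by cases simp_all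
qed

lemma ln_19_ge: "23 / 8 \<le> ln (19 :: real)"
proof -
  have "exp (23 :: real) = exp 1 ^ 23"
    by (simp add: exp_of_nat_mult[symmetric])
  also have "\<dots> \<le> 2.72 ^ 23"
    using e_less_272 by (intro power_mono) auto
  also have "\<dots> \<le> 19 ^ 8"
    by (simp add: power_divide)
  finally have "23 \<le> ln ((19 :: real) ^ 8)"
    by (simp add: ln_ge_iff)
  also have "ln ((19 :: real) ^ 8) = real 8 * ln 19"
    by (rule ln_realpow)
  finally show ?thesis
    by simp
qed

lemma e_ge: "27 / 10 \<le> exp (1 :: real)"
  using e_approx_32 by (simp add: abs_le_iff abs_if split: if_splits)

text \<open>Only the factor and \<open>B\<close> have to be nonnegative; \<open>b\<close> itself may
  change sign, which the shifted sequence below may do.\<close>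

lemma contraction_bound:
  fixes b :: "nat \<Rightarrow> real"
  assumes "1 \<le> k" "t \<le> T" "\<And>t. t < T \<Longrightarrow> b (Suc t) \<le> (1 - 1 / real k) * b t" "b 0 \<le> B" "0 \<le> B"
  shows "b t \<le> exp (- (real t / real k)) * B"
proof -
  have "b t \<le> (1 - 1 / real k) ^ t * B"
    using assms(2)
  proof (induction t)
    case (Suc t)
    then have "b (Suc t) \<le> (1 - 1 / real k) * b t"
      using assms(3) by simp
    also have "\<dots> \<le> (1 - 1 / real k) * ((1 - 1 / real k) ^ t * B)"
      using Suc assms(1) by (intro mult_left_mono) auto
    finally show ?case by (simp add: mult.assoc)
  qed (use assms in simp)
  also have "\<dots> \<le> exp (- (1 / real k)) ^ t * B"
    using assms(1,5) exp_ge_add_one_self[of "- (1 / real k)"]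
    by (intro mult_right_mono power_mono) auto
  also have "exp (- (1 / real k)) ^ t = exp (- (real t / real k))"
    by (simp add: exp_of_nat_mult[symmetric])
  finally show ?thesis .
qed

lemma greedy_steps_bound:
  fixes a :: "nat \<Rightarrow> real" and T k m p :: nat and r R :: real
  assumes pos: "\<And>t. t < T \<Longrightarrow> 0 < a t"
    and rR: "0 < r" "r \<le> R" and T: "T \<le> m"
    and step: "\<And>t. t < T \<Longrightarrow> a t \<le> real k * (a t - a (Suc t))"
    and step_more: "\<And>t. t < T \<Longrightarrow> a t + (real t - real k) * (r / real m) \<le> real k * (a t - a (Suc t))"
    and start: "a 0 \<le> real m * real p * R"
    and gap: "\<And>t. t < T \<Longrightarrow> T \<le> p \<Longrightarrow> r * (real p - (real T - 1)) / (3 * real m) \<le> a t - a (Suc t)"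
  shows "real T + 1 \<le> (1 + ln ((real m)\<^sup>2 * (R / r))) * (real k + 1)"
proof (rule ccontr)
  define L where "L = ln ((real m)\<^sup>2 * (R / r))"
  assume "\<not> ?thesis"
  then have big: "(1 + L) * (real k + 1) < real T + 1"
    by (simp add: L_def)
  have Rr: "1 \<le> R / r"
    using rR by simp
  have L: "2 * ln (real m) \<le> L" "0 \<le> L"
  proof -
    \<comment> \<open>The case \<open>m = 0\<close> is covered by \<open>ln 0 = 0\<close>.\<close>
    have "0 \<le> ln (real m)" by (cases "m = 0") auto
    moreover have "2 * ln (real m) \<le> L"
    proof (cases "m = 0")
      case False
      then have "L = ln ((real m)\<^sup>2) + ln (R / r)"
        unfolding L_def using rR by (intro ln_mult_pos) auto
      then show ?thesis
        using Rr False ln_ge_zero[OF Rr] by (simp add: ln_realpow)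
    qed (simp add: L_def)
    ultimately show "2 * ln (real m) \<le> L" "0 \<le> L" by auto
  qed
  have kT: "k < T"
  proof (rule ccontr)
    assume "\<not> k < T"
    then have "real T + 1 \<le> 1 * (real k + 1)" by simp
    also have "\<dots> \<le> (1 + L) * (real k + 1)"
      using L by (intro mult_right_mono) auto
    finally show False using big by simp
  qed
  \<comment> \<open>For \<open>k = 0\<close> the first step gives \<open>a 0 \<le> 0\<close>, for
    \<open>k = 1\<close> it gives \<open>a 1 \<le> 0\<close>. Both contradict \<open>pos\<close>, as
    \<open>k < T\<close>.\<close>
  have k2: "2 \<le> k"
  proof (rule ccontr)
    assume "\<not> 2 \<le> k"
    then consider "k = 0" | "k = 1" by linarith
    then show False
    proof cases
      case 1
      then show False using step[of 0] pos[of 0] kT by simp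
    next
      case 2
      then show False using step[of 0] pos[of 1] kT by simp
    qed
  qed
  have big2: "(1 + L) * 3 < real T + 1"
  proof -
    have "(1 + L) * 3 \<le> (1 + L) * (real k + 1)"
      using L k2 by (intro mult_left_mono) auto
    with big show ?thesis by simp
  qed
  \<comment> \<open>Since \<open>T \<le> m\<close>, the assumed failure forces \<open>m + 1 > 3 (1 + 2 ln m)\<close>.\<close>
  have m19: "19 \<le> m"
  proof (rule ccontr)
    assume "\<not> 19 \<le> m"
    then have "real m - 2 \<le> 6 * ln (real m)"
      using T kT k2 by (intro linear_le_ln) auto
    moreover have "real T \<le> real m" using T by simp
    ultimately show False
      using big2 L by argo
  qed
  have L5: "23 / 4 \<le> L"
  proof -
    have "ln 19 \<le> ln (real m)" using m19 by simp
    then show ?thesis using ln_19_ge L by linarith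
  qed
  \<comment> \<open>The last index at which the error is known to exceed the target, so
    \<open>a t > 0\<close>.\<close>
  define t where "t = T - 1"
  have t: "t < T" "real t = real T - 1" "T = Suc t"
    using kT by (auto simp: t_def)
  \<comment> \<open>\<open>27 / 4\<close> is the lower bound for \<open>1 + L\<close>, and
    \<open>T + 1 = t + 2\<close>.\<close>
  have t6: "6 * real k \<le> real t"
  proof -
    have "27 / 4 * (real k + 1) \<le> (1 + L) * (real k + 1)"
      using L5 by (intro mult_right_mono) auto
    then have "27 / 4 * (real k + 1) < real T + 1"
      using big by (rule le_less_trans)
    then have "27 / 4 * real k + 27 / 4 < real T + 1"
      by (simp add: distrib_left)
    moreover have "0 \<le> real k"
      by simp
    ultimately show ?thesis
      unfolding t(2) by argo
  qed
  have t0: "0 < real t" using t6 k2 by linarith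
  have m0: "0 < real m" using m19 by simp
  have expL: "exp L = (real m)\<^sup>2 * (R / r)"
    unfolding L_def using m0 rR by (intro exp_ln) auto
  show False
  \<comment> \<open>The threshold balances the branches: \<open>9 / 5\<close> divided by
    \<open>2 / 3\<close> is \<open>27 / 10 \<le> exp 1\<close>, while beyond it \<open>p - t\<close>
    exceeds \<open>4 / 9 * p\<close>.\<close>
  proof (cases "real p \<le> 9 / 5 * real t")
    case True
    define \<delta> where "\<delta> = r / real m"
    \<comment> \<open>The shift by \<open>2 * k\<close> absorbs the linear term of the recursion
      exactly, so that only the factor \<open>1 - 1 / k\<close> remains.\<close>
    define b where "b s = a s + (real s - 2 * real k) * \<delta>" for s
    have \<delta>: "0 < \<delta>" using rR m0 by (simp add: \<delta>_def)
    have "b (Suc s) \<le> (1 - 1 / real k) * b s" if "s < T" for s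
    proof -
      have "(a s + (real s - real k) * \<delta>) / real k \<le> a s - a (Suc s)"
        using step_more[OF that] k2 by (simp add: \<delta>_def field_simps)
      then have "b (Suc s) \<le> a s - (a s + (real s - real k) * \<delta>) / real k + (real (Suc s) - 2 * real k) * \<delta>"
        by (simp add: b_def)
      also have "\<dots> = (1 - 1 / real k) * b s"
        using k2 by (simp add: b_def field_simps)
      finally show ?thesis .
    qed
    moreover have "b 0 \<le> real m * (9 / 5 * real t) * R"
    proof -
      have "b 0 \<le> a 0" using \<delta> by (simp add: b_def)
      also have "\<dots> \<le> real m * real p * R" by (rule start)
      also have "\<dots> \<le> real m * (9 / 5 * real t) * R"
        using True rR by (intro mult_right_mono mult_left_mono) auto
      finally show ?thesis .
    qed
    ultimately have "b t \<le> exp (- (real t / real k)) * (real m * (9 / 5 * real t) * R)"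
      using k2 t(1) rR by (intro contraction_bound[of k t T b]) auto
    moreover have "2 / 3 * real t * \<delta> < b t"
    proof -
      have "2 / 3 * real t * \<delta> \<le> (real t - 2 * real k) * \<delta>"
        using t6 \<delta> by (intro mult_right_mono) auto
      then show ?thesis
        using pos[OF t(1)] by (simp add: b_def)
    qed
    ultimately have "2 / 3 * real t * \<delta> < exp (- (real t / real k)) * (real m * (9 / 5 * real t) * R)"
      by linarith
    then have "exp (real t / real k) < 27 / 10 * ((real m)\<^sup>2 * (R / r))"
      using t0 m0 rR by (simp add: \<delta>_def exp_minus field_simps power2_eq_square)
    also have "\<dots> \<le> exp 1 * exp L"
      unfolding expL using rR m0 e_ge by (intro mult_right_mono) auto
    also have "\<dots> = exp (1 + L)"
      by (simp add: exp_add)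
    finally have "real t < (1 + L) * real k"
      using k2 by (simp add: field_simps)
    then show False
      using big t(2) L5 by (simp add: distrib_left)
  next
    case False
    define \<eta> where "\<eta> = r * (real p - (real T - 1)) / (3 * real m)"
    \<comment> \<open>Up to \<open>s\<close> the plain contraction is used. Each of the
      \<open>k\<close> steps from \<open>s\<close> to \<open>t\<close> loses at least \<eta> while
      \<open>a t\<close> is still positive, hence \<open>a s > k * \<eta>\<close>.\<close>
    define s where "s = t - k"
    have s: "s \<le> T" "real s = real t - real k" "s + k = t"
      using t6 t(1) by (auto simp: s_def)
    have "T \<le> p" using False t(2) t6 k2 by linarith
    then have drop: "\<eta> \<le> a u - a (Suc u)" if "u < T" for u
      using gap[OF that] by (simp add: \<eta>_def)
    have "a (s + j) + real j * \<eta> \<le> a s" if "j \<le> k" for j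
      using that
    proof (induction j)
      case (Suc j)
      then show ?case
        using drop[of "s + j"] s(3) t(1) by (simp add: algebra_simps)
    qed simp
    from this[of k] have "real k * \<eta> < a s"
      using pos[OF t(1)] s(3) by simp
    also have "\<dots> \<le> exp (- (real s / real k)) * (real m * real p * R)"
    proof (rule contraction_bound[of k s T a])
      fix u assume "u < T"
      from step[OF this] show "a (Suc u) \<le> (1 - 1 / real k) * a u"
        using k2 by (simp add: field_simps)
    qed (use k2 s(1) start rR in auto)
    finally have up: "real k * \<eta> < exp (- (real s / real k)) * (real m * real p * R)" .
    have p0: "0 < real p" using False t0 by linarith
    have "real k * (4 * r * real p / (27 * real m)) \<le> real k * \<eta>"
    proof (rule mult_left_mono)
      have "r * (4 / 9 * real p) \<le> r * (real p - (real T - 1))"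
        using False t(2) rR by (intro mult_left_mono) auto
      then show "4 * r * real p / (27 * real m) \<le> \<eta>"
        using m0 by (simp add: \<eta>_def field_simps)
    qed simp
    with up have "real k * (4 * r * real p / (27 * real m)) < exp (- (real s / real k)) * (real m * real p * R)"
      by linarith
    then have "exp (real s / real k) < 27 / (4 * real k) * exp L"
      unfolding expL using p0 m0 rR k2 by (simp add: exp_minus field_simps power2_eq_square)
    \<comment> \<open>By \<open>x \<le> exp (x - 1)\<close>. After multiplication by
      \<open>k\<close> the \<open>- 1\<close> pays for the \<open>k\<close> steps between
      \<open>s\<close> and \<open>t\<close>.\<close>
    also have "\<dots> \<le> exp (27 / (4 * real k) - 1) * exp L"
      using exp_ge_add_one_self[of "27 / (4 * real k) - 1"] by (intro mult_right_mono) auto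
    also have "\<dots> = exp (27 / (4 * real k) - 1 + L)"
      by (simp add: exp_add)
    finally have "real s < 27 / 4 - real k + L * real k"
      using k2 by (simp add: field_simps)
    then have "real T + 1 < 35 / 4 + L * real k"
      using s(2) t(2) by linarith
    moreover have "2 \<le> real k" using k2 by simp
    \<comment> \<open>With \<open>k \<ge> 2\<close> and \<open>L \<ge> 23 / 4\<close> the slack
      \<open>1 + L + k\<close> is at least \<open>35 / 4\<close>.\<close>
    ultimately show False
      using big L5 by (simp add: algebra_simps)
  qed
qed

section \<open>Dirichlet form and hop distance\<close>

lemma double_sum_insert:
  fixes f :: "'a \<Rightarrow> 'a \<Rightarrow> real"
  assumes "finite B" "i \<notin> B"
  shows "(\<Sum>a\<in>insert i B. \<Sum>b\<in>insert i B. f a b) =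
    f i i + (\<Sum>a\<in>B. \<Sum>b\<in>B. f a b) + (\<Sum>a\<in>B. f a i) + (\<Sum>b\<in>B. f i b)"
proof -
  have "(\<Sum>a\<in>insert i B. \<Sum>b\<in>insert i B. f a b) = (\<Sum>a\<in>insert i B. f a i + (\<Sum>b\<in>B. f a b))"
    using assms by simp
  also have "\<dots> = (\<Sum>a\<in>insert i B. f a i) + (\<Sum>a\<in>insert i B. \<Sum>b\<in>B. f a b)"
    by (rule sum.distrib)
  finally show ?thesis
    using assms by simp
qed

lemma double_sum_symmetric:
  fixes f :: "'a :: linorder \<Rightarrow> 'a \<Rightarrow> real"
  assumes "finite B" "\<And>i j. f i j = f j i" "\<And>i. f i i = 0"
  shows "(\<Sum>i\<in>B. \<Sum>j\<in>B. f i j) = 2 * (\<Sum>(i, j)\<in>{(i, j). i \<in> B \<and> j \<in> B \<and> i < j}. f i j)"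
proof -
  let ?P = "{(i, j). i \<in> B \<and> j \<in> B \<and> i < j}" and ?Q = "{(i, j). i \<in> B \<and> j \<in> B \<and> j < i}"
  have fin: "finite ?P" "finite ?Q"
    using assms(1) by (auto intro: finite_subset[of _ "B \<times> B"])
  have "(\<Sum>i\<in>B. \<Sum>j\<in>B. f i j) = (\<Sum>(i, j)\<in>B \<times> B. f i j)"
    by (simp add: sum.cartesian_product)
  also have "\<dots> = (\<Sum>(i, j)\<in>?P \<union> ?Q. f i j)"
    using assms by (intro sum.mono_neutral_right) (auto, metis linorder_cases)
  also have "\<dots> = (\<Sum>(i, j)\<in>?P. f i j) + (\<Sum>(i, j)\<in>?Q. f i j)"
    using fin by (intro sum.union_disjoint) auto
  also have "(\<Sum>(i, j)\<in>?Q. f i j) = (\<Sum>(i, j)\<in>?P. f i j)"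
    using assms(2)
    by (intro sum.reindex_bij_witness[of _ "\<lambda>(i, j). (j, i)" "\<lambda>(i, j). (j, i)"]) auto
  finally show ?thesis by simp
qed

section \<open>Moments of a one-dimensional Gaussian\<close>

lemma has_bochner_integral_gaussian:
  fixes a h :: real
  assumes "0 < a"
  defines "J \<equiv> sqrt (2 * pi / a)"
  shows "has_bochner_integral lborel (\<lambda>y. exp (- (a * (y - h)\<^sup>2 / 2))) J"
    and "has_bochner_integral lborel (\<lambda>y. (y - h) * exp (- (a * (y - h)\<^sup>2 / 2))) 0"
    and "has_bochner_integral lborel (\<lambda>y. a * (y - h)\<^sup>2 * exp (- (a * (y - h)\<^sup>2 / 2))) J"
proof -
  define s where "s = 1 / sqrt a"
  have s: "0 < s" "s\<^sup>2 = 1 / a"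
    using assms by (auto simp: s_def power_divide)
  have J: "0 < J" "sqrt (2 * pi * s\<^sup>2) = J"
    using assms by (auto simp: J_def s)
  have nd: "exp (- (a * (y - h)\<^sup>2 / 2)) = J * normal_density h s y" for y
  proof -
    have "- (y - h)\<^sup>2 / (2 * s\<^sup>2) = - (a * (y - h)\<^sup>2 / 2)"
      by (simp add: s(2))
    then show ?thesis
      unfolding normal_density_def J(2) using J(1) by simp
  qed
  have "has_bochner_integral lborel (\<lambda>y. J * (normal_density h s y * (y - h) ^ (2 * 0)))
      (J * (fact (2 * 0) / ((2 / s\<^sup>2) ^ 0 * fact 0)))"
    by (intro has_bochner_integral_mult_right normal_moment_even s)
  then show "has_bochner_integral lborel (\<lambda>y. exp (- (a * (y - h)\<^sup>2 / 2))) J"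
    by (simp add: nd)
  have "has_bochner_integral lborel (\<lambda>y. J * (normal_density h s y * (y - h) ^ (2 * 0 + 1))) (J * 0)"
    by (intro has_bochner_integral_mult_right normal_moment_odd s)
  then show "has_bochner_integral lborel (\<lambda>y. (y - h) * exp (- (a * (y - h)\<^sup>2 / 2))) 0"
    by (simp add: nd mult_ac)
  have "has_bochner_integral lborel (\<lambda>y. (a * J) * (normal_density h s y * (y - h) ^ (2 * 1)))
      ((a * J) * (fact (2 * 1) / ((2 / s\<^sup>2) ^ 1 * fact 1)))"
    by (intro has_bochner_integral_mult_right normal_moment_even s)
  moreover have "(a * J) * (fact (2 * 1) / ((2 / s\<^sup>2) ^ 1 * fact 1)) = J"
    using assms(1) by (simp add: s(2) fact_numeral)
  moreover have "(a * J) * (normal_density h s y * (y - h) ^ (2 * 1)) =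
      a * (y - h)\<^sup>2 * exp (- (a * (y - h)\<^sup>2 / 2))" for y
    unfolding nd by (simp add: mult_ac)
  ultimately show "has_bochner_integral lborel (\<lambda>y. a * (y - h)\<^sup>2 * exp (- (a * (y - h)\<^sup>2 / 2))) J"
    by (simp only:)
qed

interpretation lborel_product: product_sigma_finite "\<lambda>_. lborel :: real measure"
  by standard

section \<open>Laplacian, energy and distance of a network\<close>

locale network =
  fixes n :: nat and E :: "nat set set" and r :: "nat \<Rightarrow> nat \<Rightarrow> real"
  assumes graph: "weighted_graph n E r"
begin

abbreviation "V \<equiv> {1..n}"

definition cond :: "nat \<Rightarrow> nat \<Rightarrow> real" where
  "cond i j = (if {i, j} \<in> E then 1 / r i j else 0)"

definition lap :: "(nat \<Rightarrow> real) \<Rightarrow> nat \<Rightarrow> real" where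
  "lap u k = (\<Sum>j\<in>V. cond k j * (u k - u j))"

text \<open>The halving compensates for each edge occurring in both orders.\<close>

definition dirichlet :: "(nat \<Rightarrow> real) \<Rightarrow> (nat \<Rightarrow> real) \<Rightarrow> real" where
  "dirichlet u v = (\<Sum>i\<in>V. \<Sum>j\<in>V. cond i j * (u i - u j) * (v i - v j)) / 2"

definition deg :: "nat \<Rightarrow> real" where
  "deg k = (\<Sum>j\<in>V. cond k j)"

definition adj :: "(nat \<times> nat) set" where
  "adj = {(u, v). {u, v} \<in> E}"

definition hop :: "nat \<Rightarrow> nat" where
  "hop i = (LEAST l. (1, i) \<in> adj ^^ l)"

lemma n_ge_1: "1 \<le> n"
  using graph by (simp add: weighted_graph_def)

lemma edge_in_V:
  assumes "{i, j} \<in> E"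
  shows "i \<in> V \<and> j \<in> V \<and> i \<noteq> j"
proof -
  obtain a b where "a \<in> V" "b \<in> V" "a \<noteq> b" "{i, j} = {a, b}"
    using graph assms unfolding weighted_graph_def by blast
  then show ?thesis
    by (auto simp: doubleton_eq_iff)
qed

lemma weight_pos: "{i, j} \<in> E \<Longrightarrow> 0 < r i j"
  using graph by (auto simp: weighted_graph_def)

lemma weight_sym: "{i, j} \<in> E \<Longrightarrow> r i j = r j i"
  using graph by (auto simp: weighted_graph_def)

lemma connected: "i \<in> V \<Longrightarrow> j \<in> V \<Longrightarrow> (i, j) \<in> adj\<^sup>*"
  using graph by (auto simp: weighted_graph_def adj_def)

lemma cond_sym: "cond i j = cond j i"
  using weight_sym[of i j] by (simp add: cond_def insert_commute)

lemma cond_nonneg: "0 \<le> cond i j"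
  using weight_pos[of i j] by (auto simp: cond_def less_imp_le)

lemma cond_self [simp]: "cond i i = 0"
  using edge_in_V[of i i] by (auto simp: cond_def)

lemma finite_edge_weights: "finite (edge_weights E r)"
proof (rule finite_subset)
  show "edge_weights E r \<subseteq> (\<lambda>(i, j). r i j) ` (V \<times> V)"
    using edge_in_V by (force simp: edge_weights_def)
qed simp

lemma weight_bounds:
  assumes "{i, j} \<in> E"
  shows "min_weight E r \<le> r i j" "r i j \<le> max_weight E r"
  using assms finite_edge_weights
  by (auto simp: min_weight_def max_weight_def edge_weights_def intro!: Min_le Max_ge)

lemma min_weight_pos:
  assumes "{i, j} \<in> E"
  shows "0 < min_weight E r"
proof -
  have "min_weight E r \<in> edge_weights E r"
    unfolding min_weight_def using assms
    by (intro Min_in finite_edge_weights) (auto simp: edge_weights_def)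
  then show ?thesis
    using weight_pos by (auto simp: edge_weights_def)
qed

lemma exists_neighbour:
  assumes "k \<in> V" "2 \<le> n"
  obtains j where "{k, j} \<in> E"
proof -
  obtain i where i: "i \<in> V" "i \<noteq> k"
    using assms that[of 2] that[of 1] by (cases "k = 1") simp_all
  have "(k, i) \<in> adj\<^sup>*"
    using connected assms i by blast
  then show ?thesis
    using i(2) that by (auto elim: converse_rtranclE simp: adj_def)
qed

lemma deg_pos:
  assumes "k \<in> V" "2 \<le> n"
  shows "0 < deg k"
proof -
  obtain j where j: "{k, j} \<in> E"
    using exists_neighbour assms by blast
  have "0 < cond k j"
    using j weight_pos[OF j] by (simp add: cond_def)
  also have "cond k j \<le> deg k"
    unfolding deg_def using edge_in_V[OF j] by (intro member_le_sum) (auto simp: cond_nonneg)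
  finally show ?thesis .
qed

lemma lap_alt: "lap u k = deg k * u k - (\<Sum>j\<in>V. cond k j * u j)"
  unfolding lap_def deg_def sum_distrib_right sum_subtractf[symmetric]
  by (simp add: algebra_simps)

lemma lap_add: "lap (\<lambda>i. u i + v i) k = lap u k + lap v k"
  unfolding lap_def sum.distrib[symmetric] by (simp add: algebra_simps)

lemma lap_diff: "lap (\<lambda>i. u i - v i) k = lap u k - lap v k"
  unfolding lap_def sum_subtractf[symmetric] by (simp add: algebra_simps)

lemma lap_mult: "lap (\<lambda>i. u i * a) k = lap u k * a"
  unfolding lap_def sum_distrib_right by (simp add: algebra_simps)

text \<open>Summation by parts: swap the two indices, using the symmetry of \<open>cond\<close>, and
  average.\<close>

lemma dirichlet_eq_lap: "(\<Sum>k\<in>V. v k * lap u k) = dirichlet u v"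
proof -
  have a: "(\<Sum>k\<in>V. v k * lap u k) = (\<Sum>i\<in>V. \<Sum>j\<in>V. cond i j * (u i - u j) * v i)"
    by (simp add: lap_def sum_distrib_left mult.commute)
  also have "\<dots> = (\<Sum>i\<in>V. \<Sum>j\<in>V. cond i j * (u i - u j) * - v j)"
    by (subst sum.swap) (auto intro!: sum.cong simp: cond_sym[of _ "_::nat"] algebra_simps)
  finally have b: "(\<Sum>k\<in>V. v k * lap u k) = (\<Sum>i\<in>V. \<Sum>j\<in>V. cond i j * (u i - u j) * - v j)" .
  have "(\<Sum>i\<in>V. \<Sum>j\<in>V. cond i j * (u i - u j) * v i) + (\<Sum>i\<in>V. \<Sum>j\<in>V. cond i j * (u i - u j) * - v j)
      = (\<Sum>i\<in>V. \<Sum>j\<in>V. cond i j * (u i - u j) * (v i - v j))"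
    by (simp add: sum.distrib[symmetric] algebra_simps)
  then show ?thesis
    using a b by (simp add: dirichlet_def)
qed

lemma dirichlet_commute: "dirichlet u v = dirichlet v u"
  by (simp add: dirichlet_def mult_ac)

lemma hop_1 [simp]: "hop (Suc 0) = 0"
  unfolding hop_def by (rule Least_eq_0) simp

lemma hop_path:
  assumes "i \<in> V"
  shows "(1, i) \<in> adj ^^ hop i"
proof -
  have "\<exists>l. (1, i) \<in> adj ^^ l"
    using connected[of 1 i] assms n_ge_1 by (simp add: rtrancl_power)
  then show ?thesis
    unfolding hop_def by (rule LeastI_ex)
qed

lemma hop_edge:
  assumes "{i, j} \<in> E"
  shows "hop j \<le> Suc (hop i)"
proof -
  have "(1, j) \<in> adj ^^ Suc (hop i)"
    using hop_path[of i] edge_in_V[OF assms] assms by (auto simp: adj_def)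
  then show ?thesis
    unfolding hop_def[of j] by (rule Least_le)
qed

lemma hop_pred:
  assumes "i \<in> V" "hop i = Suc l"
  obtains k where "{k, i} \<in> E" "hop k = l"
proof -
  obtain k where k: "(1, k) \<in> adj ^^ l" "{k, i} \<in> E"
    using hop_path[OF assms(1)] assms(2) by (auto simp: adj_def)
  have "hop k \<le> l"
    unfolding hop_def by (rule Least_le) (fact k)
  with hop_edge[OF k(2)] assms(2) have "hop k = l"
    by simp
  with k that show ?thesis by blast
qed

lemma hop_0:
  assumes "i \<in> V" "hop i = 0"
  shows "i = 1"
  using hop_path[OF assms(1)] assms(2) by simp

text \<open>Walking back along a shortest path from \<open>i\<close> to node 1 meets every smaller
  distance.\<close>

lemma hop_level:
  assumes "i \<in> V" "l \<le> hop i"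
  obtains k where "k \<in> V" "hop k = l"
proof -
  have "\<exists>k\<in>V. hop k = l"
    using assms
  proof (induction "hop i" arbitrary: i)
    case 0
    then show ?case by auto
  next
    case (Suc x)
    show ?case
    proof (cases "l = hop i")
      case False
      obtain k where k: "{k, i} \<in> E" "hop k = x"
        using hop_pred Suc by metis
      then show ?thesis
        using Suc False edge_in_V[OF k(1)] by (metis Suc.hyps(1) le_SucE)
    qed (use Suc in auto)
  qed
  then show ?thesis using that by blast
qed

text \<open>Cauchy-Schwarz along a shortest path from node 1, where \<open>u\<close> vanishes, each
  weight on it being at most \<open>max_weight E r\<close>. The path is never named: the induction
  runs over hop balls, whose energy grows by at least that of the last edge.\<close>

lemma square_le_hop_dirichlet:
  assumes "i \<in> V" "u 1 = 0"
  shows "(u i)\<^sup>2 \<le> real (hop i) * (max_weight E r * dirichlet u u)"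
proof -
  define B where "B l = {i\<in>V. hop i \<le> l}" for l
  define D where "D l = (\<Sum>i\<in>B l. \<Sum>j\<in>B l. cond i j * (u i - u j)\<^sup>2) / 2" for l
  let ?R = "max_weight E r"
  have fin: "finite (B l)" for l
    by (simp add: B_def)
  have nonneg: "0 \<le> cond i j * (u i - u j)\<^sup>2" for i j
    by (simp add: cond_nonneg)
  have D_le: "D l \<le> dirichlet u u" for l
  proof -
    have "(\<Sum>i\<in>B l. \<Sum>j\<in>B l. cond i j * (u i - u j)\<^sup>2) \<le> (\<Sum>i\<in>V. \<Sum>j\<in>V. cond i j * (u i - u j)\<^sup>2)"
    proof -
      have "(\<Sum>i\<in>B l. \<Sum>j\<in>B l. cond i j * (u i - u j)\<^sup>2) \<le> (\<Sum>i\<in>B l. \<Sum>j\<in>V. cond i j * (u i - u j)\<^sup>2)"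
        by (intro sum_mono sum_mono2) (auto simp: B_def nonneg)
      also have "\<dots> \<le> (\<Sum>i\<in>V. \<Sum>j\<in>V. cond i j * (u i - u j)\<^sup>2)"
        by (intro sum_mono2) (auto simp: B_def nonneg sum_nonneg)
      finally show ?thesis .
    qed
    then show ?thesis
      by (simp add: D_def dirichlet_def power2_eq_square mult.assoc)
  qed
  have "(u i)\<^sup>2 \<le> real (hop i) * (?R * D (hop i))"
    using assms(1)
  proof (induction "hop i" arbitrary: i)
    case 0
    then show ?case using hop_0[of i] assms(2) by simp
  next
    case (Suc l)
    obtain k where k: "{k, i} \<in> E" "hop k = l"
      using hop_pred Suc.prems Suc.hyps(2) by metis
    have kV: "k \<in> V" "i \<in> V" "k \<noteq> i"
      using edge_in_V[OF k(1)] by auto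
    have IH: "(u k)\<^sup>2 \<le> real l * (?R * D l)"
      using Suc.hyps(1)[of k] k kV by simp
    have rpos: "0 < r k i" "r k i \<le> ?R"
      using weight_pos[OF k(1)] weight_bounds[OF k(1)] by auto
    have iB: "i \<in> B (Suc l)" "i \<notin> B l" "k \<in> B l" "B l \<subseteq> B (Suc l)"
      using k kV Suc.hyps(2) by (auto simp: B_def)
    define e where "e = u i - u k"
    \<comment> \<open>The last edge joins \<open>B l\<close> to a node outside it, so
      \<open>D l\<close> does not count it yet; the double sum over the larger ball meets it in both
      orders.\<close>
    have step: "D l + cond k i * e\<^sup>2 \<le> D (Suc l)"
    proof -
      have "2 * D l + 2 * (cond k i * e\<^sup>2) =
          (\<Sum>a\<in>B l. \<Sum>b\<in>B l. cond a b * (u a - u b)\<^sup>2) + cond k i * (u k - u i)\<^sup>2 + cond i k * (u i - u k)\<^sup>2"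
        by (simp add: D_def e_def cond_sym[of i k] power2_commute[of "u k"])
      also have "\<dots> \<le> (\<Sum>a\<in>B l. \<Sum>b\<in>B l. cond a b * (u a - u b)\<^sup>2)
          + (\<Sum>a\<in>B l. cond a i * (u a - u i)\<^sup>2) + (\<Sum>b\<in>B l. cond i b * (u i - u b)\<^sup>2)"
        by (rule add_mono[OF add_mono[OF order.refl
              member_le_sum[OF iB(3), of "\<lambda>a. cond a i * (u a - u i)\<^sup>2"]]
              member_le_sum[OF iB(3), of "\<lambda>b. cond i b * (u i - u b)\<^sup>2"]])
          (simp_all add: nonneg fin)
      also have "\<dots> = (\<Sum>a\<in>insert i (B l). \<Sum>b\<in>insert i (B l). cond a b * (u a - u b)\<^sup>2)"
        by (subst double_sum_insert) (simp_all add: iB(2) fin)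
      also have "\<dots> \<le> 2 * D (Suc l)"
      proof -
        have "(\<Sum>a\<in>insert i (B l). \<Sum>b\<in>insert i (B l). cond a b * (u a - u b)\<^sup>2)
            \<le> (\<Sum>a\<in>insert i (B l). \<Sum>b\<in>B (Suc l). cond a b * (u a - u b)\<^sup>2)"
          using iB by (intro sum_mono sum_mono2) (auto simp: fin nonneg)
        also have "\<dots> \<le> (\<Sum>a\<in>B (Suc l). \<Sum>b\<in>B (Suc l). cond a b * (u a - u b)\<^sup>2)"
          using iB by (intro sum_mono2) (auto simp: fin nonneg sum_nonneg)
        finally show ?thesis by (simp add: D_def)
      qed
      finally show ?thesis by simp
    qed
    have "e\<^sup>2 \<le> ?R * (cond k i * e\<^sup>2)"
    proof -
      have "1 * e\<^sup>2 \<le> (?R * cond k i) * e\<^sup>2"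
        using rpos k(1) by (intro mult_right_mono) (auto simp: cond_def)
      then show ?thesis by (simp add: mult.assoc)
    qed
    moreover have "?R * D l + ?R * (cond k i * e\<^sup>2) \<le> ?R * D (Suc l)"
      using mult_left_mono[OF step, of ?R] rpos by (simp add: algebra_simps)
    ultimately have le: "?R * D l + e\<^sup>2 \<le> ?R * D (Suc l)"
      by simp
    \<comment> \<open>Cauchy-Schwarz for one more edge, from \<open>(x - l * e)^2 \<ge> 0\<close>. A
      division by \<open>l\<close> sets the case \<open>l = 0\<close> apart.\<close>
    have cs: "(x + e)\<^sup>2 \<le> (real l + 1) * (y + e\<^sup>2)" if "x\<^sup>2 \<le> real l * y" "0 \<le> y" for x y
    proof (cases "l = 0")
      case True
      then show ?thesis using that by simp
    next
      case False
      then have lp: "0 < real l" by simp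
      have "0 \<le> (x - real l * e)\<^sup>2"
        by simp
      then have "2 * (real l * (x * e)) \<le> x\<^sup>2 + (real l)\<^sup>2 * e\<^sup>2"
        by (simp add: power2_eq_square algebra_simps)
      then have "real l * (x + e)\<^sup>2 \<le> (real l + 1) * (x\<^sup>2 + real l * e\<^sup>2)"
        by (simp add: power2_eq_square algebra_simps)
      also have "\<dots> \<le> (real l + 1) * (real l * y + real l * e\<^sup>2)"
        using that by (intro mult_left_mono) auto
      also have "\<dots> = real l * ((real l + 1) * (y + e\<^sup>2))"
        by (simp add: algebra_simps)
      finally show ?thesis
        using lp by (simp only: mult_le_cancel_left_pos)
    qed
    have "(u i)\<^sup>2 = (u k + e)\<^sup>2"
      by (simp add: e_def)
    also have "\<dots> \<le> (real l + 1) * (?R * D l + e\<^sup>2)"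
      using cs[OF IH] rpos by (simp add: D_def sum_nonneg nonneg)
    also have "\<dots> \<le> (real l + 1) * (?R * D (Suc l))"
      using le by (intro mult_left_mono) auto
    finally show ?case
      using Suc.hyps(2)[symmetric] by (simp add: add.commute)
  qed
  also have "\<dots> \<le> real (hop i) * (?R * dirichlet u u)"
  proof (cases "hop i")
    case (Suc l)
    then obtain k where "{k, i} \<in> E"
      using hop_pred assms(1) by blast
    then have "0 \<le> ?R"
      using weight_bounds weight_pos by (meson less_eq_real_def order_trans)
    then show ?thesis
      using D_le by (intro mult_left_mono) auto
  qed simp
  finally show ?thesis .
qed

section \<open>Second moments of the Gaussian free field\<close>

abbreviation "N \<equiv> {2..n}"
abbreviation X :: "(nat \<Rightarrow> real) \<Rightarrow> nat \<Rightarrow> real" where "X w \<equiv> (\<lambda>i. gff_coord i w)"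
abbreviation "ref \<equiv> gff_reference n"
abbreviation "energy \<equiv> gff_energy n E r"
abbreviation "M \<equiv> gff n E r"

definition boltzmann :: "(nat \<Rightarrow> real) \<Rightarrow> real" where
  "boltzmann w = exp (- energy w)"

lemma gff_energy_dirichlet: "energy w = dirichlet (X w) (X w) / 2"
proof -
  let ?f = "\<lambda>i j. cond i j * (X w i - X w j)\<^sup>2"
  have "dirichlet (X w) (X w) = (\<Sum>i\<in>V. \<Sum>j\<in>V. ?f i j) / 2"
    by (simp add: dirichlet_def power2_eq_square mult.assoc)
  also have "\<dots> = (\<Sum>(i, j)\<in>{(i, j). i \<in> V \<and> j \<in> V \<and> i < j}. ?f i j)"
    by (subst double_sum_symmetric) (auto simp: cond_sym power2_commute)
  also have "\<dots> = (\<Sum>(i, j)\<in>{(i, j). i \<in> V \<and> j \<in> V \<and> i < j \<and> {i, j} \<in> E}. ?f i j)"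
    by (intro sum.mono_neutral_right finite_subset[of "{(i, j). i \<in> V \<and> j \<in> V \<and> i < j}" "V \<times> V"])
      (auto simp: cond_def split: if_splits)
  also have "\<dots> = (\<Sum>(i, j)\<in>{(i, j). i \<in> V \<and> j \<in> V \<and> i < j \<and> {i, j} \<in> E}.
      2 * ((X w i - X w j)\<^sup>2 / (2 * r i j)))"
    by (intro sum.cong) (auto simp: cond_def)
  also have "\<dots> = 2 * energy w"
    unfolding gff_energy_def sum_distrib_left by (rule sum.cong) auto
  finally show ?thesis by simp
qed

lemma dirichlet_nonneg: "0 \<le> dirichlet u u"
  unfolding dirichlet_def using cond_nonneg by (auto intro!: sum_nonneg simp: mult.assoc)

text \<open>The perturbation lives at \<open>k\<close> only, so by bilinearity and summation by
  parts the energy is a quadratic polynomial in the shift \<open>s\<close>.\<close>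

lemma dirichlet_add_site:
  assumes "k \<in> V"
  shows "dirichlet (\<lambda>i. u i + (if i = k then s else 0)) (\<lambda>i. u i + (if i = k then s else 0))
    = dirichlet u u + 2 * s * lap u k + s\<^sup>2 * deg k"
proof -
  define e :: "nat \<Rightarrow> real" where "e i = (if i = k then s else 0)" for i
  have add: "dirichlet (\<lambda>i. u i + e i) v = dirichlet u v + dirichlet e v" for v
    by (simp add: dirichlet_eq_lap[symmetric] lap_add distrib_left sum.distrib)
  have e: "dirichlet v e = s * lap v k" for v
    using assms by (simp add: dirichlet_eq_lap[symmetric] e_def if_distrib[of "\<lambda>x. x * _"] cong: if_cong)
  have "(\<Sum>j\<in>V. cond k j * e j) = 0"
    by (auto intro!: sum.neutral simp: e_def)
  then have "lap e k = deg k * s"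
    by (simp add: lap_alt) (simp add: e_def)
  then show ?thesis
    unfolding e_def[symmetric]
    by (simp add: add dirichlet_commute[of _ "\<lambda>i. u i + e i"] dirichlet_commute[of e u] e power2_eq_square)
qed

section \<open>One coordinate of the field, given the others\<close>

definition site_mean :: "nat \<Rightarrow> (nat \<Rightarrow> real) \<Rightarrow> real" where
  "site_mean k w = (\<Sum>j\<in>V. cond k j * X w j) / deg k"

context
  fixes k
  assumes k: "k \<in> N"
begin

lemma k_facts: "k \<in> V" "2 \<le> n" "k \<noteq> 1" "0 < deg k"
  using k deg_pos[of k] by auto

lemma lap_upd: "lap (X (w(k := y))) k = deg k * (y - site_mean k w)"
proof -
  have "(\<Sum>j\<in>V. cond k j * X (w(k := y)) j) = (\<Sum>j\<in>V. cond k j * X w j)"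
    by (rule sum.cong) (auto simp: gff_coord_def)
  then show ?thesis
    using k_facts by (simp add: lap_alt site_mean_def gff_coord_def algebra_simps)
qed

lemma coord_upd: "X (w(k := y)) k = y"
  using k_facts by (simp add: gff_coord_def)

text \<open>Completing the square: the energy is expanded around \<open>site_mean k w\<close>, where
  \<open>lap\<close> vanishes at \<open>k\<close> and the linear term drops out.\<close>

lemma boltzmann_upd:
  "boltzmann (w(k := y)) = boltzmann (w(k := site_mean k w)) * exp (- (deg k * (y - site_mean k w)\<^sup>2 / 2))"
proof -
  let ?h = "site_mean k w"
  have "X (w(k := y)) = (\<lambda>i. X (w(k := ?h)) i + (if i = k then y - ?h else 0))"
    using k_facts by (auto simp: gff_coord_def)
  then have "energy (w(k := y)) = energy (w(k := ?h)) + deg k * (y - ?h)\<^sup>2 / 2"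
    using dirichlet_add_site[OF k_facts(1), of "X (w(k := ?h))" "y - ?h"]
    by (simp add: gff_energy_dirichlet lap_upd add_divide_distrib)
  then show ?thesis
    by (simp add: boltzmann_def exp_add[symmetric])
qed

lemma integral_site:
  fixes f :: "(nat \<Rightarrow> real) \<Rightarrow> real"
  assumes "integrable ref f"
  shows "(\<integral>w. f w \<partial>ref) = (\<integral>w. (\<integral>y. f (w(k := y)) \<partial>lborel) \<partial>Pi\<^sub>M (N - {k}) (\<lambda>_. lborel))"
proof -
  have "ref = Pi\<^sub>M (insert k (N - {k})) (\<lambda>_. lborel)"
    using k by (simp add: gff_reference_def insert_absorb)
  then show ?thesis
    using lborel_product.product_integral_insert[of "N - {k}" k f] assms by simp
qed

text \<open>
  Given the other coordinates, coordinate \<open>k\<close> is Gaussian with mean \<open>site_mean k w\<close> and variance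
  \<open>1 / deg k\<close>, and \<open>lap (X w) k\<close> is its rescaled deviation from that mean.
\<close>

lemma integral_site_lap_eq_0:
  assumes "integrable ref (\<lambda>w. f w * lap (X w) k * boltzmann w)" "\<And>w y. f (w(k := y)) = f w"
  shows "(\<integral>w. f w * lap (X w) k * boltzmann w \<partial>ref) = 0"
proof -
  have "(\<integral>y. f (w(k := y)) * lap (X (w(k := y))) k * boltzmann (w(k := y)) \<partial>lborel) = 0" for w
  proof -
    let ?h = "site_mean k w"
    have "has_bochner_integral lborel (\<lambda>y. (f w * deg k * boltzmann (w(k := ?h))) *
        ((y - ?h) * exp (- (deg k * (y - ?h)\<^sup>2 / 2)))) ((f w * deg k * boltzmann (w(k := ?h))) * 0)"
      by (intro has_bochner_integral_mult_right has_bochner_integral_gaussian k_facts)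
    moreover have "f (w(k := y)) * lap (X (w(k := y))) k * boltzmann (w(k := y)) =
        (f w * deg k * boltzmann (w(k := ?h))) * ((y - ?h) * exp (- (deg k * (y - ?h)\<^sup>2 / 2)))" for y
      by (subst boltzmann_upd) (simp add: lap_upd assms(2))
    ultimately have "has_bochner_integral lborel
        (\<lambda>y. f (w(k := y)) * lap (X (w(k := y))) k * boltzmann (w(k := y))) 0"
      by (simp only: mult_zero_right)
    then show ?thesis
      by (rule has_bochner_integral_integral_eq)
  qed
  then show ?thesis
    by (subst integral_site[OF assms(1)]) simp
qed

text \<open>Split the coordinate into its deviation from \<open>site_mean k w\<close> and the mean
  itself. The mean integrates to 0 against the deviation, and \<open>deg k\<close> times the squared
  deviation integrates to the mass of the weight.\<close>

lemma integral_site_self: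
  assumes "integrable ref (\<lambda>w. X w k * lap (X w) k * boltzmann w)" "integrable ref boltzmann"
  shows "(\<integral>w. X w k * lap (X w) k * boltzmann w \<partial>ref) = (\<integral>w. boltzmann w \<partial>ref)"
proof -
  have "(\<integral>y. X (w(k := y)) k * lap (X (w(k := y))) k * boltzmann (w(k := y)) \<partial>lborel)
      = (\<integral>y. boltzmann (w(k := y)) \<partial>lborel)" for w
  proof -
    let ?h = "site_mean k w" and ?J = "sqrt (2 * pi / deg k)"
    let ?w = "boltzmann (w(k := ?h))" and ?g = "\<lambda>y. exp (- (deg k * (y - site_mean k w)\<^sup>2 / 2))"
    have "has_bochner_integral lborel (\<lambda>y. ?w * (deg k * (y - ?h)\<^sup>2 * ?g y) +
        (?w * deg k * ?h) * ((y - ?h) * ?g y)) (?w * ?J + (?w * deg k * ?h) * 0)"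
      by (intro has_bochner_integral_add has_bochner_integral_mult_right
          has_bochner_integral_gaussian k_facts)
    moreover have "?w * (deg k * (y - ?h)\<^sup>2 * ?g y) + (?w * deg k * ?h) * ((y - ?h) * ?g y)
        = X (w(k := y)) k * lap (X (w(k := y))) k * boltzmann (w(k := y))" for y
      by (subst (3) boltzmann_upd) (simp add: lap_upd coord_upd power2_eq_square algebra_simps)
    ultimately have "has_bochner_integral lborel
        (\<lambda>y. X (w(k := y)) k * lap (X (w(k := y))) k * boltzmann (w(k := y))) (?w * ?J)"
      by simp
    moreover have "has_bochner_integral lborel (\<lambda>y. boltzmann (w(k := y))) (?w * ?J)"
      by (subst boltzmann_upd, intro has_bochner_integral_mult_right has_bochner_integral_gaussian k_facts)
    ultimately show ?thesis
      by (simp add: has_bochner_integral_integral_eq)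
  qed
  then show ?thesis
    by (simp add: integral_site[OF assms(1)] integral_site[OF assms(2)])
qed

end

section \<open>Integrability, normalisation and covariances\<close>

lemma coord_measurable [measurable]:
  assumes "i \<in> V"
  shows "(\<lambda>w. gff_coord i w) \<in> borel_measurable ref"
proof (cases "i = 1")
  case False
  with assms have "i \<in> N" by simp
  then have "(\<lambda>w. w i) \<in> measurable ref lborel"
    unfolding gff_reference_def by (rule measurable_component_singleton)
  then show ?thesis
    using False by (simp add: gff_coord_def measurable_lborel1)
qed (simp add: gff_coord_def)

lemma energy_measurable [measurable]: "energy \<in> borel_measurable ref"
proof -
  have "energy = (\<lambda>w. (\<Sum>i\<in>V. \<Sum>j\<in>V. cond i j * (X w i - X w j) * (X w i - X w j)) / 2 / 2)"
    by (rule ext) (simp add: gff_energy_dirichlet dirichlet_def)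
  also have "\<dots> \<in> borel_measurable ref"
    by measurable
  finally show ?thesis .
qed

lemma boltzmann_measurable [measurable]: "boltzmann \<in> borel_measurable ref"
  unfolding boltzmann_def[abs_def] by measurable

lemma energy_coercive:
  obtains \<kappa> where "0 < \<kappa>" "\<And>w. \<kappa> * (\<Sum>i\<in>N. (w i)\<^sup>2) \<le> energy w"
proof
  \<comment> \<open>\<open>max 0\<close> and \<open>+ 1\<close> make \<open>K\<close> positive
    without information on \<open>max_weight E r\<close>, which is unspecified for
    \<open>n = 1\<close>.\<close>
  define K where "K = max 0 (\<Sum>i\<in>N. real (hop i) * max_weight E r * 2) + 1"
  have K: "0 < K" by (simp add: K_def)
  then show "0 < 1 / K" by simp
  fix w :: "nat \<Rightarrow> real"
  have en: "0 \<le> energy w"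
    by (simp add: gff_energy_dirichlet dirichlet_nonneg)
  have "(\<Sum>i\<in>N. (w i)\<^sup>2) \<le> (\<Sum>i\<in>N. (real (hop i) * max_weight E r * 2) * energy w)"
  proof (rule sum_mono)
    fix i assume "i \<in> N"
    then show "(w i)\<^sup>2 \<le> (real (hop i) * max_weight E r * 2) * energy w"
      using square_le_hop_dirichlet[of i "X w"]
      by (simp add: gff_energy_dirichlet gff_coord_def mult.assoc)
  qed
  also have "\<dots> = (\<Sum>i\<in>N. real (hop i) * max_weight E r * 2) * energy w"
    by (rule sum_distrib_right[symmetric])
  also have "\<dots> \<le> K * energy w"
    unfolding K_def by (intro mult_right_mono en) linarith
  finally show "1 / K * (\<Sum>i\<in>N. (w i)\<^sup>2) \<le> energy w"
    using K by (simp add: field_simps)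
qed

text \<open>Half of the Gaussian decay absorbs the quadratic growth of \<open>f\<close>; the other
  half is a product of one-dimensional Gaussians.\<close>

lemma integrable_W:
  assumes [measurable]: "f \<in> borel_measurable ref"
    and f: "\<And>w. \<bar>f w\<bar> \<le> 1 + (\<Sum>i\<in>N. (w i)\<^sup>2)"
  shows "integrable ref (\<lambda>w. f w * boltzmann w)"
proof -
  obtain \<kappa> where \<kappa>: "0 < \<kappa>" "\<And>w. \<kappa> * (\<Sum>i\<in>N. (w i)\<^sup>2) \<le> energy w"
    using energy_coercive by blast
  have "integrable lborel (\<lambda>y. exp (- (\<kappa> * y\<^sup>2 / 2)))"
    using has_bochner_integral_gaussian(1)[OF \<kappa>(1), of 0] by (auto simp: has_bochner_integral_iff)
  then have "integrable ref (\<lambda>w. (1 + 2 / \<kappa>) * (\<Prod>i\<in>N. exp (- (\<kappa> * (w i)\<^sup>2 / 2))))"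
    unfolding gff_reference_def
    by (intro integrable_mult_right lborel_product.product_integrable_prod) auto
  then show ?thesis
  proof (rule Bochner_Integration.integrable_bound)
    show "AE w in ref. norm (f w * boltzmann w) \<le> norm ((1 + 2 / \<kappa>) * (\<Prod>i\<in>N. exp (- (\<kappa> * (w i)\<^sup>2 / 2))))"
    proof (rule AE_I2)
      fix w :: "nat \<Rightarrow> real"
      define q where "q = (\<Sum>i\<in>N. (w i)\<^sup>2)"
      have q: "0 \<le> q" by (simp add: q_def sum_nonneg)
      have prod: "(\<Prod>i\<in>N. exp (- (\<kappa> * (w i)\<^sup>2 / 2))) = exp (- (\<kappa> * q / 2))"
        by (simp add: exp_sum[symmetric] q_def sum_distrib_left sum_divide_distrib sum_negf)
      have le1: "q \<le> 2 / \<kappa> * exp (\<kappa> * q / 2)"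
        using exp_ge_add_one_self[of "\<kappa> * q / 2"] \<kappa>(1) by (simp add: field_simps)
      have le2: "1 \<le> exp (\<kappa> * q / 2)"
        using q \<kappa>(1) by simp
      have "1 + q \<le> (1 + 2 / \<kappa>) * exp (\<kappa> * q / 2)"
        using add_mono[OF le2 le1] by (simp only: distrib_right mult_1_left)
      then have "\<bar>f w\<bar> \<le> (1 + 2 / \<kappa>) * exp (\<kappa> * q / 2)"
        using f[of w] by (simp add: q_def)
      moreover have "boltzmann w \<le> exp (- (\<kappa> * q))"
        using \<kappa>(2)[of w] by (simp add: boltzmann_def q_def)
      ultimately have "\<bar>f w\<bar> * boltzmann w \<le> ((1 + 2 / \<kappa>) * exp (\<kappa> * q / 2)) * exp (- (\<kappa> * q))"
        using \<kappa>(1) by (intro mult_mono) (auto simp: boltzmann_def)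
      also have "\<dots> = (1 + 2 / \<kappa>) * exp (- (\<kappa> * q / 2))"
        by (simp add: exp_add[symmetric] mult.assoc)
      finally show "norm (f w * boltzmann w) \<le> norm ((1 + 2 / \<kappa>) * (\<Prod>i\<in>N. exp (- (\<kappa> * (w i)\<^sup>2 / 2))))"
        unfolding prod using \<kappa>(1) by (simp add: abs_mult boltzmann_def)
    qed
  qed measurable
qed

definition partition_fun :: real where "partition_fun = (\<integral>w. boltzmann w \<partial>ref)"

lemma integrable_W_self: "integrable ref boltzmann"
  using integrable_W[of "\<lambda>_. 1"] by (simp add: sum_nonneg)

text \<open>The integrand is positive everywhere, so a zero integral would make the reference
  measure of the whole space vanish.\<close>

lemma partition_fun_pos: "0 < partition_fun"
proof -
  have "partition_fun \<noteq> 0"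
  proof
    assume "partition_fun = 0"
    then have "AE w in ref. boltzmann w = 0"
      unfolding partition_fun_def using integral_nonneg_eq_0_iff_AE[OF integrable_W_self] by (simp add: boltzmann_def)
    then have "AE w in ref. False"
      by (simp add: boltzmann_def)
    then have "emeasure ref (space ref) = 0"
      by (auto simp: AE_iff_measurable[OF sets.top])
    moreover have "emeasure ref (space ref) = (\<Prod>i\<in>N. emeasure lborel (UNIV :: real set))"
      unfolding gff_reference_def space_PiM
      by (subst lborel_product.emeasure_PiM) auto
    ultimately show False
      by (simp add: prod_zero_iff)
  qed
  moreover have "0 \<le> partition_fun"
    unfolding partition_fun_def by (intro Bochner_Integration.integral_nonneg) (simp add: boltzmann_def)
  ultimately show ?thesis by simp
qed

lemma gff_alt: "M = density ref (\<lambda>w. ennreal (boltzmann w / partition_fun))"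
  by (simp add: gff_def boltzmann_def partition_fun_def)

lemma space_M [simp]: "space M = space ref"
  by (simp add: gff_alt)

lemma sets_M [measurable_cong]: "sets M = sets ref"
  by (simp add: gff_alt)

lemma integral_M:
  assumes [measurable]: "f \<in> borel_measurable ref"
  shows "(\<integral>w. f w \<partial>M) = (\<integral>w. f w * boltzmann w \<partial>ref) / partition_fun"
proof -
  have "(\<integral>w. f w \<partial>M) = (\<integral>w. (boltzmann w / partition_fun) *\<^sub>R f w \<partial>ref)"
    unfolding gff_alt using partition_fun_pos by (intro integral_density) (auto simp: boltzmann_def)
  then show ?thesis
    by (simp add: mult.commute)
qed

lemma integrable_M_iff:
  assumes [measurable]: "f \<in> borel_measurable ref"
  shows "integrable M f \<longleftrightarrow> integrable ref (\<lambda>w. f w * boltzmann w)"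
proof -
  have "integrable M f \<longleftrightarrow> integrable ref (\<lambda>w. (boltzmann w / partition_fun) *\<^sub>R f w)"
    unfolding gff_alt using partition_fun_pos by (intro integrable_density) (auto simp: boltzmann_def)
  also have "(\<lambda>w. (boltzmann w / partition_fun) *\<^sub>R f w) = (\<lambda>w. (f w * boltzmann w) * (1 / partition_fun))"
    by (simp add: mult.commute)
  also have "integrable ref \<dots> \<longleftrightarrow> integrable ref (\<lambda>w. f w * boltzmann w)"
    unfolding integrable_mult_right_iff using partition_fun_pos by simp
  finally show ?thesis .
qed

lemma prob_space_M: "prob_space M"
proof
  have int: "integrable ref (\<lambda>w. boltzmann w / partition_fun)"
    using integrable_W_self by simp
  have "emeasure M (space M) = (\<integral>\<^sup>+w. ennreal (boltzmann w / partition_fun) * indicator (space ref) w \<partial>ref)"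
    unfolding space_M by (subst gff_alt, rule emeasure_density) auto
  also have "\<dots> = (\<integral>\<^sup>+w. ennreal (boltzmann w / partition_fun) \<partial>ref)"
    by (intro nn_integral_cong) simp
  also have "\<dots> = ennreal (\<integral>w. boltzmann w / partition_fun \<partial>ref)"
    using partition_fun_pos by (intro nn_integral_eq_integral int) (simp add: boltzmann_def)
  also have "(\<integral>w. boltzmann w / partition_fun \<partial>ref) = 1"
    using partition_fun_pos by (simp add: partition_fun_def)
  finally show "emeasure M (space M) = 1" by simp
qed

lemma abs_coord_mult_le:
  assumes "i \<in> V" "j \<in> V"
  shows "\<bar>X w i * X w j\<bar> \<le> (\<Sum>i\<in>N. (w i)\<^sup>2)"
proof -
  have sq: "(X w i)\<^sup>2 \<le> (\<Sum>i\<in>N. (w i)\<^sup>2)" if "i \<in> V" for i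
  proof (cases "i = 1")
    case False
    then have "(w i)\<^sup>2 \<le> (\<Sum>i\<in>N. (w i)\<^sup>2)"
      using that by (intro member_le_sum) auto
    then show ?thesis using False by (simp add: gff_coord_def)
  qed (simp add: gff_coord_def sum_nonneg)
  have "2 * \<bar>x * y\<bar> \<le> x\<^sup>2 + y\<^sup>2" for x y :: real
    using sum_squares_bound[of "\<bar>x\<bar>" "\<bar>y\<bar>"] by (simp add: abs_mult)
  from this[of "X w i" "X w j"] sq[OF assms(1)] sq[OF assms(2)] show ?thesis by simp
qed

lemma integrable_coord_mult:
  assumes "i \<in> V" "j \<in> V"
  shows "integrable M (\<lambda>w. X w i * X w j)"
  using assms abs_coord_mult_le[OF assms]
  by (subst integrable_M_iff) (auto intro!: integrable_W simp: add_increasing)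

lemma integrable_coord:
  assumes "i \<in> V"
  shows "integrable M (\<lambda>w. X w i)"
proof -
  have "\<bar>x\<bar> \<le> 1 + \<bar>x * x\<bar>" for x :: real
    using sum_squares_bound[of "\<bar>x\<bar>" 1] by (simp add: power2_eq_square abs_mult) 
  then have "\<bar>X w i\<bar> \<le> 1 + (\<Sum>i\<in>N. (w i)\<^sup>2)" for w
    using abs_coord_mult_le[OF assms assms, of w] by (meson add_left_mono order_trans)
  then show ?thesis
    using assms by (subst integrable_M_iff) (auto intro!: integrable_W)
qed

lemma lap_measurable [measurable]:
  assumes "k \<in> V"
  shows "(\<lambda>w. lap (X w) k) \<in> borel_measurable ref"
  unfolding lap_def using assms by measurable

lemma integrable_lap:
  assumes "k \<in> V"
  shows "integrable M (\<lambda>w. lap (X w) k)"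
  unfolding lap_def using assms
  by (intro Bochner_Integration.integrable_sum integrable_mult_right Bochner_Integration.integrable_diff integrable_coord)

lemma integrable_coord_lap:
  assumes "i \<in> V" "k \<in> V"
  shows "integrable M (\<lambda>w. X w i * lap (X w) k)"
proof -
  have "(\<lambda>w. X w i * lap (X w) k) = (\<lambda>w. \<Sum>j\<in>V. cond k j * (X w i * X w k - X w i * X w j))"
    by (rule ext) (simp add: lap_def sum_distrib_left algebra_simps)
  moreover have "integrable M (\<lambda>w. \<Sum>j\<in>V. cond k j * (X w i * X w k - X w i * X w j))"
    using assms by (intro Bochner_Integration.integrable_sum integrable_mult_right
        Bochner_Integration.integrable_diff integrable_coord_mult)
  ultimately show ?thesis by simp
qed

text \<open>In matrix terms, the covariance inverts the Laplacian on \<open>N\<close>. Off the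
  diagonal \<open>X w i\<close> does not involve coordinate \<open>k\<close>, and the deviation at
  \<open>k\<close> has conditional mean 0.\<close>

lemma expectation_coord_lap:
  assumes "i \<in> V" "k \<in> N"
  shows "(\<integral>w. X w i * lap (X w) k \<partial>M) = (if i = k then 1 else 0)"
proof -
  have kV: "k \<in> V" using assms(2) by simp
  have meas: "(\<lambda>w. X w i * lap (X w) k) \<in> borel_measurable ref"
    using assms(1) kV by measurable
  have int: "integrable ref (\<lambda>w. X w i * lap (X w) k * boltzmann w)"
    using integrable_coord_lap[OF assms(1) kV] integrable_M_iff[OF meas] by simp
  show ?thesis
  proof (cases "i = k")
    case True
    then show ?thesis
      using integral_site_self[OF assms(2)] int integrable_W_self partition_fun_pos integral_M[OF meas]
      by (simp add: partition_fun_def[symmetric])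
  next
    case False
    then show ?thesis
      using integral_site_lap_eq_0[OF assms(2) int] integral_M[OF meas] by (simp add: gff_coord_def)
  qed
qed

text \<open>The orthogonality behind the conditional expectations: the event ignores coordinate
  \<open>k\<close>, and given the others \<open>lap (X w) k\<close> has mean 0.\<close>

lemma integral_indicator_lap:
  assumes "k \<in> N" "A \<in> sets ref" "\<And>w y. w(k := y) \<in> A \<longleftrightarrow> w \<in> A"
  shows "(\<integral>w. indicator A w * lap (X w) k \<partial>M) = 0"
proof -
  have kV: "k \<in> V" using assms(1) by simp
  note [measurable] = assms(2)
  have meas: "(\<lambda>w. indicator A w * lap (X w) k) \<in> borel_measurable ref"
    using kV by measurable
  have "integrable M (\<lambda>w. indicator A w *\<^sub>R lap (X w) k)"
    by (intro integrable_mult_indicator integrable_lap kV) (simp add: sets_M assms(2))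
  then have "integrable ref (\<lambda>w. indicator A w * lap (X w) k * boltzmann w)"
    using integrable_M_iff[OF meas] by simp
  then show ?thesis
    using integral_site_lap_eq_0[OF assms(1), of "indicator A"] integral_M[OF meas] assms(3)
    by (simp add: indicator_def)
qed

section \<open>Green functions\<close>

text \<open>The inverse of the Laplacian restricted to \<open>A\<close>, extended by zero. It is
  stated as a property: existence comes from the covariance, uniqueness from
  \<open>green_transpose\<close>.\<close>

definition green :: "nat set \<Rightarrow> (nat \<Rightarrow> nat \<Rightarrow> real) \<Rightarrow> bool" where
  "green A g \<longleftrightarrow>
     (\<forall>i j. i \<notin> A \<or> j \<notin> A \<longrightarrow> g i j = 0) \<and>
     (\<forall>j\<in>A. \<forall>k\<in>A. lap (\<lambda>i. g i j) k = (if k = j then 1 else 0))"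

lemma green_zero: "green A g \<Longrightarrow> i \<notin> A \<or> j \<notin> A \<Longrightarrow> g i j = 0"
  by (auto simp: green_def)

lemma green_lap: "green A g \<Longrightarrow> j \<in> A \<Longrightarrow> k \<in> A \<Longrightarrow> lap (\<lambda>i. g i j) k = (if k = j then 1 else 0)"
  by (auto simp: green_def)

text \<open>Reproducing property: by summation by parts only a unit mass at \<open>j\<close> is
  tested, since \<open>v\<close> vanishes off \<open>A\<close>.\<close>

lemma dirichlet_green:
  assumes "green A g" "A \<subseteq> V" "j \<in> A" "\<And>k. k \<notin> A \<Longrightarrow> v k = 0"
  shows "dirichlet (\<lambda>i. g i j) v = v j"
proof -
  have "dirichlet (\<lambda>i. g i j) v = (\<Sum>k\<in>V. v k * lap (\<lambda>i. g i j) k)"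
    by (rule dirichlet_eq_lap[symmetric])
  also have "\<dots> = (\<Sum>k\<in>A. v k * lap (\<lambda>i. g i j) k)"
    using assms by (intro sum.mono_neutral_right) auto
  also have "\<dots> = (\<Sum>k\<in>A. if k = j then v k else 0)"
    using assms by (intro sum.cong) (auto simp: green_lap)
  also have "\<dots> = v j"
    using assms finite_subset[OF assms(2)] by simp
  finally show ?thesis .
qed

text \<open>Both sides are the energy of a column of \<open>g\<close> against a column of
  \<open>h\<close>. For \<open>g = h\<close> this is symmetry; together with symmetry it gives
  uniqueness.\<close>

lemma green_transpose:
  assumes "green A g" "green A h" "A \<subseteq> V"
  shows "g i j = h j i"
proof (cases "i \<in> A \<and> j \<in> A")
  case True
  have "g i j = dirichlet (\<lambda>k. h k i) (\<lambda>k. g k j)"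
    using dirichlet_green[OF assms(2,3), of i "\<lambda>k. g k j"] True green_zero[OF assms(1)] by simp
  also have "\<dots> = h j i"
    using dirichlet_green[OF assms(1,3), of j "\<lambda>k. h k i"] True green_zero[OF assms(2)]
    by (simp add: dirichlet_commute)
  finally show ?thesis .
next
  case False
  then show ?thesis
    using green_zero[OF assms(1)] green_zero[OF assms(2)] by metis
qed

text \<open>The diagonal entry is the energy of its column. Zero energy would make the column
  vanish, as it is grounded at node 1, but its Laplacian at \<open>j\<close> is 1.\<close>

lemma green_diag_pos:
  assumes "green A g" "A \<subseteq> N" "j \<in> A"
  shows "0 < g j j"
proof (rule ccontr)
  assume "\<not> 0 < g j j"
  moreover have D: "dirichlet (\<lambda>i. g i j) (\<lambda>i. g i j) = g j j"
    using assms green_zero[OF assms(1)] by (intro dirichlet_green) auto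
  ultimately have D0: "dirichlet (\<lambda>i. g i j) (\<lambda>i. g i j) = 0"
    using dirichlet_nonneg[of "\<lambda>i. g i j"] by simp
  have "1 \<notin> A"
    using assms(2) by auto
  then have "g 1 j = 0"
    using green_zero[OF assms(1)] by blast
  then have "g i j = 0" if "i \<in> V" for i
    using square_le_hop_dirichlet[of i "\<lambda>i. g i j"] that D0 by simp
  then have "lap (\<lambda>i. g i j) j = 0"
    using assms by (auto simp: lap_def intro!: sum.neutral)
  then show False
    using green_lap[OF assms(1,3,3)] by simp
qed

text \<open>Maximum principle: the negative part \<open>v\<close> of the column \<open>u\<close>
  satisfies \<open>dirichlet v v \<le> dirichlet u v = v j = 0\<close>, and a function of zero
  energy grounded at node 1 vanishes.\<close>

lemma green_nonneg:
  assumes "green A g" "A \<subseteq> N"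
  shows "0 \<le> g i j"
proof (cases "i \<in> A \<and> j \<in> A")
  case True
  define u where "u = (\<lambda>i. g i j)"
  define v where "v = (\<lambda>i. min (u i) 0)"
  have *: "(min a 0 - min b 0) * (min a 0 - min b 0) \<le> (a - b) * (min a 0 - min b 0)" for a b :: real
    by (auto simp: min_def algebra_simps mult_nonneg_nonpos mult_nonneg_nonpos2 mult_nonpos_nonneg)
  have "dirichlet v v \<le> dirichlet u v"
    unfolding dirichlet_def v_def mult.assoc
    by (intro divide_right_mono sum_mono mult_left_mono * cond_nonneg) simp
  also have "\<dots> = v j"
    unfolding u_def using assms True green_zero[OF assms(1)]
    by (intro dirichlet_green) (auto simp: v_def u_def)
  also have "v j = 0"
    using green_diag_pos[OF assms] True by (simp add: v_def u_def)
  finally have "dirichlet v v = 0"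
    using dirichlet_nonneg[of v] by simp
  moreover have "1 \<notin> A"
    using assms(2) by auto
  then have "v 1 = 0"
    using green_zero[OF assms(1)] by (simp add: v_def u_def del: One_nat_def)
  ultimately have "v i = 0"
    using square_le_hop_dirichlet[of i v] True assms(2) by auto
  then show ?thesis
    by (simp add: v_def u_def min_def split: if_splits)
next
  case False
  then show ?thesis
    using green_zero[OF assms(1), of i j] by auto
qed

text \<open>Schur complement: the Green function after grounding one more node.\<close>

lemma green_remove:
  assumes "green A g" "A \<subseteq> N" "x \<in> A"
  shows "green (A - {x}) (\<lambda>i j. g i j - g i x * g j x / g x x)"
proof -
  have pos: "0 < g x x"
    using assms by (rule green_diag_pos)
  have sym: "g i j = g j i" for i j
    using green_transpose[OF assms(1,1)] assms(2) by force
  have "lap (\<lambda>i. g i j - g i x * g j x / g x x) k = (if k = j then 1 else 0)"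
    if "j \<in> A - {x}" "k \<in> A - {x}" for j k
  proof -
    have "lap (\<lambda>i. g i j - g i x * (g j x / g x x)) k = lap (\<lambda>i. g i j) k - lap (\<lambda>i. g i x) k * (g j x / g x x)"
      by (simp only: lap_diff lap_mult)
    then show ?thesis
      using that assms green_lap[OF assms(1)] by simp
  qed
  moreover have "g i j - g i x * g j x / g x x = 0" if ij: "i \<notin> A - {x} \<or> j \<notin> A - {x}" for i j
  proof -
    consider "i \<notin> A" | "j \<notin> A" | "i = x" | "j = x"
      using ij by blast
    then show ?thesis
      using pos green_zero[OF assms(1)] sym[of x j] by cases simp_all
  qed
  ultimately show ?thesis
    unfolding green_def by blast
qed

text \<open>The base case for existence. The extension by zero agrees with the field at node 1,
  where the coordinate is pinned to 0.\<close>

lemma green_covariance: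
  "green N (\<lambda>i j. if i \<in> N \<and> j \<in> N then \<integral>w. X w i * X w j \<partial>M else 0)"
proof -
  define C where "C = (\<lambda>i j. if i \<in> N \<and> j \<in> N then \<integral>w. X w i * X w j \<partial>M else 0)"
  have C: "C i j = (\<integral>w. X w i * X w j \<partial>M)" if "i \<in> V" "j \<in> N" for i j
    using that by (auto simp: C_def gff_coord_def)
  have "lap (\<lambda>i. C i j) k = (if k = j then 1 else 0)" if "j \<in> N" "k \<in> N" for j k
  proof -
    have V: "j \<in> V" "k \<in> V" using that by auto
    have "lap (\<lambda>i. C i j) k = (\<Sum>l\<in>V. \<integral>w. cond k l * (X w k * X w j - X w l * X w j) \<partial>M)"
      unfolding lap_def using V that(1) by (intro sum.cong) (simp_all add: C integrable_coord_mult)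
    also have "\<dots> = (\<integral>w. (\<Sum>l\<in>V. cond k l * (X w k * X w j - X w l * X w j)) \<partial>M)"
      using V by (intro Bochner_Integration.integral_sum[symmetric] integrable_mult_right
          Bochner_Integration.integrable_diff integrable_coord_mult)
    also have "\<dots> = (\<integral>w. X w j * lap (X w) k \<partial>M)"
      by (simp add: lap_def sum_distrib_left algebra_simps)
    finally show ?thesis
      using expectation_coord_lap[OF V(1) that(2)] by auto
  qed
  then show ?thesis
    unfolding C_def[symmetric] by (auto simp: green_def) (auto simp: C_def)
qed

definition green_fun :: "nat set \<Rightarrow> nat \<Rightarrow> nat \<Rightarrow> real" where
  "green_fun A = (SOME g. green A g)"

text \<open>Start from the covariance and ground the nodes of \<open>N - A\<close> one at a
  time.\<close>

lemma green_G:
  assumes "A \<subseteq> N"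
  shows "green A (green_fun A)"
proof -
  have "\<exists>g. green (N - B) g" if "finite B" "B \<subseteq> N" for B
    using that
  proof (induction B rule: finite_induct)
    case empty
    then show ?case using green_covariance by auto
  next
    case (insert x B)
    then obtain g where "green (N - B) g" by auto
    then have "green (N - B - {x}) (\<lambda>i j. g i j - g i x * g j x / g x x)"
      using insert by (intro green_remove) auto
    then show ?case
      by (metis Diff_insert)
  qed
  from this[of "N - A"] have "\<exists>g. green A g"
    using assms by (simp add: double_diff)
  then show ?thesis
    unfolding green_fun_def by (rule someI_ex)
qed

lemma green_fun_zero: "A \<subseteq> N \<Longrightarrow> i \<notin> A \<or> j \<notin> A \<Longrightarrow> green_fun A i j = 0"
  using green_zero[OF green_G] .

lemma N_subset_V: "A \<subseteq> N \<Longrightarrow> A \<subseteq> V"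
  by auto

lemma green_fun_sym: "A \<subseteq> N \<Longrightarrow> green_fun A i j = green_fun A j i"
  by (intro green_transpose[of A] green_G N_subset_V)

lemma green_fun_pos: "A \<subseteq> N \<Longrightarrow> j \<in> A \<Longrightarrow> 0 < green_fun A j j"
  using green_diag_pos[OF green_G] .

lemma green_fun_nonneg: "A \<subseteq> N \<Longrightarrow> 0 \<le> green_fun A i j"
  using green_nonneg[OF green_G] .

text \<open>By uniqueness the chosen function agrees with the Schur complement; the transposed
  indices are restored by symmetry.\<close>

lemma green_fun_remove:
  assumes "A \<subseteq> N" "x \<in> A"
  shows "green_fun (A - {x}) i j = green_fun A i j - green_fun A i x * green_fun A j x / green_fun A x x"
proof -
  have AV: "A - {x} \<subseteq> V" using assms(1) by auto
  have "green_fun (A - {x}) i j = green_fun A j i - green_fun A j x * green_fun A i x / green_fun A x x"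
    using green_transpose[OF green_G green_remove[OF green_G] AV] assms by blast
  then show ?thesis
    using green_fun_sym[OF assms(1), of i j] by (simp add: mult.commute)
qed

section \<open>Trace of the Green function and gain of a node\<close>

definition green_trace :: "nat set \<Rightarrow> real" where
  "green_trace A = (\<Sum>i\<in>V. green_fun A i i)"

definition gain :: "nat set \<Rightarrow> nat \<Rightarrow> real" where
  "gain A x = (\<Sum>i\<in>V. (green_fun A i x)\<^sup>2 / green_fun A x x)"

lemma green_trace_remove:
  assumes "A \<subseteq> N" "x \<in> A"
  shows "green_trace (A - {x}) = green_trace A - gain A x"
  unfolding green_trace_def gain_def sum_subtractf[symmetric]
  using green_fun_remove[OF assms] by (simp add: power2_eq_square)

lemma green_fun_diag_ge:
  assumes "A \<subseteq> N" "x \<in> A"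
  shows "1 / deg x \<le> green_fun A x x"
proof -
  have x: "x \<in> V" "2 \<le> n" using assms by auto
  have "1 = lap (\<lambda>i. green_fun A i x) x"
    using green_lap[OF green_G[OF assms(1)] assms(2,2)] by simp
  also have "\<dots> \<le> deg x * green_fun A x x"
    unfolding lap_alt using cond_nonneg green_fun_nonneg[OF assms(1)] by (simp add: sum_nonneg)
  finally show ?thesis
    using deg_pos[OF x] by (simp add: field_simps)
qed

lemma gain_ge:
  assumes "A \<subseteq> N" "x \<in> A"
  shows "1 / deg x \<le> gain A x"
proof -
  have "1 / deg x \<le> green_fun A x x"
    using assms by (rule green_fun_diag_ge)
  also have "\<dots> = (green_fun A x x)\<^sup>2 / green_fun A x x"
    using green_fun_pos[OF assms] by (simp add: power2_eq_square)
  also have "\<dots> \<le> gain A x"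
    unfolding gain_def using assms green_fun_nonneg[OF assms(1)]
    by (intro member_le_sum) auto
  finally show ?thesis .
qed

text \<open>Supermodularity in local form: each term is \<open>a * (a / b)\<close>, and grounding
  \<open>y\<close> increases neither factor.\<close>

lemma gain_remove_le:
  assumes "A \<subseteq> N" "x \<in> A" "y \<in> A" "x \<noteq> y"
  shows "gain (A - {y}) x \<le> gain A x"
  unfolding gain_def
proof (rule sum_mono)
  fix i
  let ?a = "green_fun A i x" and ?b = "green_fun A x x" and ?a' = "green_fun (A - {y}) i x" and ?b' = "green_fun (A - {y}) x x"
  let ?p = "green_fun A i y" and ?q = "green_fun A x y" and ?z = "green_fun A y y"
  have Ay: "A - {y} \<subseteq> N" and Ax: "A - {x} \<subseteq> N" using assms(1) by auto
  have pos: "0 < ?b" "0 < ?z" "0 < ?b'" "0 \<le> ?a" "0 \<le> ?a'" "0 \<le> ?q" "0 \<le> ?p"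
    using green_fun_pos[OF assms(1)] green_fun_pos[OF Ay, of x] green_fun_nonneg[OF assms(1)] green_fun_nonneg[OF Ay] assms by auto
  have a': "?a' = ?a - ?p * ?q / ?z" and b': "?b' = ?b - ?q * ?q / ?z"
    using green_fun_remove[OF assms(1,3)] by auto
  \<comment> \<open>Monotonicity of the ratio is the positivity of the Green function killed at \<open>x\<close> instead of \<open>y\<close>.\<close>
  have "0 \<le> green_fun (A - {x}) i y"
    by (rule green_fun_nonneg[OF Ax])
  then have "?a * ?q / ?b \<le> ?p"
    using green_fun_remove[OF assms(1,2), of i y] green_fun_sym[OF assms(1), of x y] by simp
  then have "?a * ?q \<le> ?p * ?b"
    using pos by (simp add: field_simps)
  then have "(?a * ?q) * ?q \<le> (?p * ?b) * ?q"
    using pos by (intro mult_right_mono) auto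
  then have "(?a * ?q) * ?q / ?z \<le> (?p * ?b) * ?q / ?z"
    using pos by (intro divide_right_mono) auto
  then have "?a' * ?b \<le> ?a * ?b'"
    unfolding a' b' by (simp add: algebra_simps)
  then have ratio: "?a' / ?b' \<le> ?a / ?b"
    using pos by (simp add: field_simps)
  have "?a' \<le> ?a"
    unfolding a' using pos by simp
  then have "?a' * (?a' / ?b') \<le> ?a * (?a / ?b)"
    using ratio pos by (intro mult_mono) auto
  then show "?a'\<^sup>2 / ?b' \<le> ?a\<^sup>2 / ?b"
    by (simp add: power2_eq_square)
qed

lemma gain_mono:
  assumes "A \<subseteq> N" "B \<subseteq> A" "x \<in> B"
  shows "gain B x \<le> gain A x"
proof -
  have "gain (A - C) x \<le> gain A x" if "finite C" "C \<subseteq> A - {x}" for C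
    using that
  proof (induction C rule: finite_induct)
    case (insert y C)
    have "gain (A - C - {y}) x \<le> gain (A - C) x"
      using insert assms by (intro gain_remove_le) auto
    also have "\<dots> \<le> gain A x"
      using insert by auto
    finally show ?case by (metis Diff_insert)
  qed simp
  from this[of "A - B"] show ?thesis
    using assms finite_subset[of "A - B" N] by (auto simp: double_diff)
qed

text \<open>The path inequality for the column of \<open>i\<close>, whose energy is the diagonal
  entry itself; one factor of it cancels.\<close>

lemma green_fun_le_hop:
  assumes "i \<in> V"
  shows "green_fun N i i \<le> real (hop i) * max_weight E r"
proof (cases "i = 1")
  case False
  then have i: "i \<in> N" using assms by auto
  have "(green_fun N i i)\<^sup>2 \<le> real (hop i) * (max_weight E r * green_fun N i i)"
    using square_le_hop_dirichlet[OF assms, of "\<lambda>k. green_fun N k i"]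
      dirichlet_green[OF green_G[of N] _ i, of "\<lambda>k. green_fun N k i"] green_fun_zero[of N] by auto
  then have "green_fun N i i * green_fun N i i \<le> (real (hop i) * max_weight E r) * green_fun N i i"
    by (simp add: power2_eq_square mult.assoc)
  then show ?thesis
    using green_fun_pos[of N i] i by (simp only: mult_le_cancel_right_pos)
qed (simp add: green_fun_zero)

section \<open>Prediction errors\<close>

context
  fixes S i
  assumes S: "1 \<in> S" "S \<subseteq> V" and i: "i \<in> V"
begin

abbreviation (input) "U \<equiv> V - S"
abbreviation (input) "FS \<equiv> observed M gff_coord S"
abbreviation (input) "obs \<equiv> (\<lambda>w. \<lambda>k\<in>S. gff_coord k w)"

text \<open>The prediction error of coordinate \<open>i\<close>. Written through \<open>lap\<close>,
  it combines deviations at unobserved nodes only, because the Green function vanishes off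
  \<open>U\<close>.\<close>

definition residual :: "(nat \<Rightarrow> real) \<Rightarrow> real" where
  "residual w = (\<Sum>k\<in>V. green_fun U k i * lap (X w) k)"

text \<open>For unobserved \<open>i\<close> the weights are the harmonic measure of \<open>S\<close>
  seen from \<open>i\<close>; for observed \<open>i\<close> the predictor is the coordinate
  itself.\<close>

definition predictor :: "(nat \<Rightarrow> real) \<Rightarrow> real" where
  "predictor w = (\<Sum>k\<in>S. ((if k = i then 1 else 0) - lap (\<lambda>l. green_fun U l i) k) * X w k)"

lemma U_subset: "U \<subseteq> N"
  using S by (auto simp: Suc_le_eq le_less)

lemma S_finite: "finite S"
  using S finite_subset by blast

text \<open>Summation by parts moves \<open>lap\<close> onto the Green function, where on
  \<open>U\<close> it is a unit mass at \<open>i\<close> (or 0 if \<open>i\<close> is observed). The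
  remaining terms live on \<open>S\<close>.\<close>

lemma coord_decomp: "X w i = predictor w + residual w"
proof -
  let ?g = "\<lambda>l. green_fun U l i"
  have "residual w = (\<Sum>k\<in>V. X w k * lap ?g k)"
    unfolding residual_def dirichlet_eq_lap by (rule dirichlet_commute)
  also have "\<dots> = (\<Sum>k\<in>S. X w k * lap ?g k) + (\<Sum>k\<in>U. X w k * lap ?g k)"
    using S by (subst sum.subset_diff[of S]) auto
  also have "(\<Sum>k\<in>U. X w k * lap ?g k) = (\<Sum>k\<in>U. if k = i then X w k else 0)"
  proof (rule sum.cong)
    fix k assume k: "k \<in> U"
    show "X w k * lap ?g k = (if k = i then X w k else 0)"
    proof (cases "i \<in> U")
      case True
      then show ?thesis
        using green_lap[OF green_G[OF U_subset] True k] by simp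
    next
      case False
      then have "lap ?g k = 0"
        using green_fun_zero[OF U_subset] by (simp add: lap_def)
      then show ?thesis using False k by auto
    qed
  qed simp
  also have "\<dots> = (if i \<in> U then X w i else 0)"
    by simp
  finally have res: "residual w = (\<Sum>k\<in>S. X w k * lap ?g k) + (if i \<in> U then X w i else 0)" .
  have "predictor w = (\<Sum>k\<in>S. if k = i then X w k else 0) - (\<Sum>k\<in>S. X w k * lap ?g k)"
    unfolding predictor_def sum_subtractf[symmetric] by (intro sum.cong) (auto simp: algebra_simps)
  also have "(\<Sum>k\<in>S. if k = i then X w k else 0) = (if i \<in> S then X w i else 0)"
    using S_finite by simp
  finally show ?thesis
    using res i by auto
qed

lemma obs_measurable: "obs \<in> measurable M (\<Pi>\<^sub>M k\<in>S. borel)"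
proof (rule measurable_restrict)
  fix k assume "k \<in> S"
  then have "(\<lambda>w. gff_coord k w) \<in> borel_measurable ref"
    using S by (intro coord_measurable) auto
  then show "(\<lambda>w. gff_coord k w) \<in> borel_measurable M"
    by (simp add: measurable_cong_sets[OF sets_M refl])
qed

lemma subalgebra_observed: "subalgebra M FS"
  unfolding subalgebra_def observed_def
  using sets_image_in_sets[OF refl obs_measurable] by simp

lemma sigma_finite_observed: "sigma_finite_subalgebra M FS"
proof -
  interpret prob_space M by (rule prob_space_M)
  have "finite_measure_subalgebra M FS"
    by unfold_locales (rule subalgebra_observed)
  then show ?thesis
    by (rule finite_measure_subalgebra_is_sigma_finite)
qed

lemma predictor_measurable: "predictor \<in> borel_measurable FS"
proof -
  have obs: "obs \<in> measurable FS (\<Pi>\<^sub>M k\<in>S. borel)"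
    unfolding observed_def by (rule measurable_vimage_algebra1) (auto simp: space_PiM)
  have "(\<lambda>w. gff_coord k w) \<in> borel_measurable FS" if "k \<in> S" for k
    using measurable_compose[OF obs measurable_component_singleton[OF that]] that by simp
  then show ?thesis
    unfolding predictor_def[abs_def] by (intro borel_measurable_sum borel_measurable_times) auto
qed

lemma integrable_residual: "integrable M residual"
  unfolding residual_def[abs_def]
  by (intro Bochner_Integration.integrable_sum integrable_mult_right integrable_lap)

lemma integrable_predictor: "integrable M predictor"
  unfolding predictor_def[abs_def] using S
  by (intro Bochner_Integration.integrable_sum integrable_mult_right integrable_coord) auto

text \<open>\<open>B\<close> is determined by the coordinates in \<open>S\<close>, so changing an
  unobserved coordinate does not affect it, and only \<open>lap\<close> at unobserved nodes enters
  the residual.\<close>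

lemma integral_indicator_residual:
  assumes "B \<in> sets FS"
  shows "(\<integral>w. indicator B w * residual w \<partial>M) = 0"
proof -
  have "obs \<in> space M \<rightarrow> space (\<Pi>\<^sub>M k\<in>S. borel)"
    by (auto simp: space_PiM)
  then obtain C where B: "B = obs -` C \<inter> space M"
    using assms unfolding observed_def by (auto simp: sets_vimage_algebra2)
  have Bref: "B \<in> sets ref"
    using assms subalgebra_observed sets_M by (auto simp: subalgebra_def)
  have zero: "green_fun U k i * (\<integral>w. indicator B w * lap (X w) k \<partial>M) = 0" for k
  proof (cases "k \<in> U")
    case True
    then have k: "k \<in> N" "k \<notin> S" using U_subset by auto
    have "w(k := y) \<in> B \<longleftrightarrow> w \<in> B" for w y
    proof -
      have "obs (w(k := y)) = obs w"
        using k(2) by (intro restrict_ext) (auto simp: gff_coord_def)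
      moreover have "w(k := y) \<in> space M \<longleftrightarrow> w \<in> space M"
        using k(1) by (auto simp: gff_reference_def space_PiM PiE_def extensional_def)
      ultimately show ?thesis
        by (simp add: B del: space_M)
    qed
    then show ?thesis
      using integral_indicator_lap[OF k(1) Bref] by simp
  next
    case False
    then have "green_fun U k i = 0"
      using green_fun_zero[OF U_subset] by blast
    then show ?thesis by simp
  qed
  have "integrable M (\<lambda>w. green_fun U k i * (indicator B w * lap (X w) k))" if "k \<in> V" for k
    using integrable_mult_indicator[OF _ integrable_lap[OF that], of B] Bref
    by (intro integrable_mult_right) (simp add: sets_M)
  then have "(\<integral>w. (\<Sum>k\<in>V. green_fun U k i * (indicator B w * lap (X w) k)) \<partial>M) =
      (\<Sum>k\<in>V. \<integral>w. green_fun U k i * (indicator B w * lap (X w) k) \<partial>M)"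
    by (intro Bochner_Integration.integral_sum)
  also have "\<dots> = 0"
    by (intro sum.neutral ballI) (simp only: integral_mult_right_zero zero)
  finally show ?thesis
    by (simp add: residual_def sum_distrib_left mult_ac)
qed

lemma cond_exp_coord: "AE w in M. real_cond_exp M FS (gff_coord i) w = predictor w"
proof (rule sigma_finite_subalgebra.real_cond_exp_charact[OF sigma_finite_observed])
  fix B assume B: "B \<in> sets FS"
  then have BM: "B \<in> sets M"
    using subalgebra_observed by (auto simp: subalgebra_def)
  have "(LINT w:B|M. gff_coord i w) = (\<integral>w. indicator B w *\<^sub>R predictor w + indicator B w *\<^sub>R residual w \<partial>M)"
    unfolding set_lebesgue_integral_def by (subst coord_decomp) (simp add: distrib_left)
  also have "\<dots> = (\<integral>w. indicator B w *\<^sub>R predictor w \<partial>M) + (\<integral>w. indicator B w *\<^sub>R residual w \<partial>M)"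
    by (intro Bochner_Integration.integral_add integrable_mult_indicator BM integrable_predictor
        integrable_residual)
  also have "(\<integral>w. indicator B w *\<^sub>R residual w \<partial>M) = 0"
    using integral_indicator_residual[OF B] by simp
  finally show "(LINT w:B|M. gff_coord i w) = (LINT w:B|M. predictor w)"
    by (simp add: set_lebesgue_integral_def)
qed (use integrable_coord[OF i] integrable_predictor predictor_measurable in auto)

lemma integrable_coord_residual:
  assumes "l \<in> V"
  shows "integrable M (\<lambda>w. X w l * residual w)"
proof -
  have "integrable M (\<lambda>w. \<Sum>k\<in>V. green_fun U k i * (X w l * lap (X w) k))"
    using assms by (intro Bochner_Integration.integrable_sum integrable_mult_right integrable_coord_lap)
  then show ?thesis
    by (simp add: residual_def sum_distrib_left mult_ac)
qed

lemma expectation_coord_residual: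
  assumes "l \<in> V"
  shows "(\<integral>w. X w l * residual w \<partial>M) = green_fun U l i"
proof -
  have "(\<integral>w. X w l * residual w \<partial>M) = (\<integral>w. (\<Sum>k\<in>V. green_fun U k i * (X w l * lap (X w) k)) \<partial>M)"
    by (simp add: residual_def sum_distrib_left mult_ac)
  also have "\<dots> = (\<Sum>k\<in>V. \<integral>w. green_fun U k i * (X w l * lap (X w) k) \<partial>M)"
    using assms by (intro Bochner_Integration.integral_sum integrable_mult_right integrable_coord_lap)
  also have "\<dots> = (\<Sum>k\<in>V. if k = l then green_fun U k i else 0)"
  proof (rule sum.cong)
    fix k
    show "(\<integral>w. green_fun U k i * (X w l * lap (X w) k) \<partial>M) = (if k = l then green_fun U k i else 0)"
    proof (cases "k \<in> U")
      case True
      then show ?thesis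
        using U_subset expectation_coord_lap[OF assms, of k] by auto
    next
      case False
      then have "green_fun U k i = 0"
        using green_fun_zero[OF U_subset] by blast
      then show ?thesis by auto
    qed
  qed simp
  also have "\<dots> = green_fun U l i"
    using assms by simp
  finally show ?thesis .
qed

text \<open>Expand one factor as coordinate minus predictor. The coordinate contributes the diagonal
  entry; the predictor contributes entries of the Green function at observed nodes, which are
  0.\<close>

lemma residual_square: 
  "has_bochner_integral M (\<lambda>w. (residual w)\<^sup>2) (green_fun U i i)"
proof -
  define b where "b k = (if k = i then 1 else 0) - lap (\<lambda>l. green_fun U l i) k" for k
  have hb: "has_bochner_integral M (\<lambda>w. X w l * residual w) (green_fun U l i)" if "l \<in> V" for l
    using integrable_coord_residual[OF that] expectation_coord_residual[OF that]
    by (simp add: has_bochner_integral_iff)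
  have "has_bochner_integral M
      (\<lambda>w. X w i * residual w - (\<Sum>k\<in>S. b k * (X w k * residual w)))
      (green_fun U i i - (\<Sum>k\<in>S. b k * green_fun U k i))"
    using S i by (intro has_bochner_integral_diff has_bochner_integral_sum
        has_bochner_integral_mult_right hb) auto
  moreover have "X w i * residual w - (\<Sum>k\<in>S. b k * (X w k * residual w)) = (residual w)\<^sup>2" for w
  proof -
    have "(\<Sum>k\<in>S. b k * (X w k * residual w)) = predictor w * residual w"
      unfolding predictor_def b_def[symmetric] sum_distrib_right by (simp only: mult.assoc)
    moreover have "X w i * residual w = predictor w * residual w + (residual w)\<^sup>2"
      by (subst coord_decomp) (simp add: power2_eq_square distrib_right)
    ultimately show ?thesis by simp
  qed
  moreover have "(\<Sum>k\<in>S. b k * green_fun U k i) = 0"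
    using green_fun_zero[OF U_subset] by (intro sum.neutral) auto
  ultimately show ?thesis
    by simp
qed

lemma expectation_cond_variance: "(\<integral>w. cond_variance M FS (gff_coord i) w \<partial>M) = green_fun U i i"
proof -
  interpret sigma_finite_subalgebra M FS
    by (rule sigma_finite_observed)
  let ?P = "real_cond_exp M FS (gff_coord i)"
  have meas [measurable]: "gff_coord i \<in> borel_measurable M" "?P \<in> borel_measurable M"
      "residual \<in> borel_measurable M"
    using integrable_coord[OF i] integrable_residual by auto
  have eq: "AE w in M. (residual w)\<^sup>2 = (gff_coord i w - ?P w)\<^sup>2"
    using cond_exp_coord
  proof eventually_elim
    case (elim w)
    then show ?case
      using coord_decomp[of w] by simp
  qed
  have res: "integrable M (\<lambda>w. (residual w)\<^sup>2)" "(\<integral>w. (residual w)\<^sup>2 \<partial>M) = green_fun U i i"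
    using residual_square by (auto simp: has_bochner_integral_iff)
  have int: "integrable M (\<lambda>w. (gff_coord i w - ?P w)\<^sup>2)"
    by (rule integrable_cong_AE_imp[OF res(1) _ eq]) measurable
  have "(\<integral>w. cond_variance M FS (gff_coord i) w \<partial>M) = (\<integral>w. (gff_coord i w - ?P w)\<^sup>2 \<partial>M)"
    unfolding cond_variance_def by (rule real_cond_exp_int(2)[OF int])
  also have "\<dots> = (\<integral>w. (residual w)\<^sup>2 \<partial>M)"
    using eq by (intro integral_cong_AE) (measurable, auto)
  finally show ?thesis
    using res by simp
qed

end

lemma err_eq:
  assumes "1 \<in> S" "S \<subseteq> V"
  shows "err n E r S = green_trace (V - S) / real n"
  unfolding err_def green_trace_def using expectation_cond_variance[OF assms] by simp

section \<open>The greedy bound\<close>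

definition nbrs :: "nat \<Rightarrow> nat set" where
  "nbrs k = {j\<in>V. {k, j} \<in> E}"

lemma finite_nbrs [simp]: "finite (nbrs k)"
  by (simp add: nbrs_def)

lemma deg_le:
  assumes "k \<in> V" "2 \<le> n"
  shows "deg k \<le> real (card (nbrs k)) / min_weight E r"
proof -
  have "deg k = (\<Sum>j\<in>nbrs k. cond k j)"
    unfolding deg_def nbrs_def by (intro sum.mono_neutral_right) (auto simp: cond_def)
  also have "\<dots> \<le> (\<Sum>j\<in>nbrs k. 1 / min_weight E r)"
    using weight_bounds min_weight_pos
    by (intro sum_mono) (auto simp: nbrs_def cond_def intro!: divide_left_mono mult_pos_pos weight_pos)
  finally show ?thesis by simp
qed

lemma weights_pos:
  assumes "2 \<le> n"
  shows "0 < min_weight E r" "min_weight E r \<le> max_weight E r"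
proof -
  obtain j where "{1, j} \<in> E"
    using exists_neighbour[of 1] assms by auto
  from min_weight_pos[OF this] weight_bounds[OF this]
  show "0 < min_weight E r" "min_weight E r \<le> max_weight E r" by auto
qed

lemma gain_ge_card_nbrs:
  assumes "A \<subseteq> N" "x \<in> A"
  shows "min_weight E r / real (card (nbrs x)) \<le> gain A x"
proof -
  have x: "x \<in> V" "2 \<le> n" using assms by auto
  have "min_weight E r / real (card (nbrs x)) \<le> 1 / deg x"
  proof -
    have "1 / (real (card (nbrs x)) / min_weight E r) \<le> 1 / deg x"
      using deg_le[OF x] deg_pos[OF x] by (intro divide_left_mono mult_pos_pos) linarith+
    then show ?thesis by simp
  qed
  also have "\<dots> \<le> gain A x"
    using assms by (rule gain_ge)
  finally show ?thesis .
qed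

lemma card_nbrs_pos:
  assumes "x \<in> N"
  shows "0 < card (nbrs x)"
proof -
  obtain j where "{x, j} \<in> E"
    using exists_neighbour[of x] assms by auto
  then show ?thesis
    using edge_in_V by (auto simp: card_gt_0_iff nbrs_def)
qed

lemma gain_ge_delta:
  assumes "A \<subseteq> N" "x \<in> A"
  shows "min_weight E r / real (n - 1) \<le> gain A x"
proof -
  have x: "x \<in> N" "x \<in> V" "2 \<le> n" using assms by auto
  have "nbrs x \<subseteq> V - {x}"
    using edge_in_V by (auto simp: nbrs_def)
  then have "card (nbrs x) \<le> card (V - {x})"
    by (intro card_mono) auto
  also have "card (V - {x}) = n - 1"
    using x(2) by (subst card_Diff_singleton) auto
  finally have "min_weight E r / real (n - 1) \<le> min_weight E r / real (card (nbrs x))"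
    using card_nbrs_pos[OF x(1)] weights_pos[OF x(3)] by (intro divide_left_mono mult_pos_pos) auto
  also have "\<dots> \<le> gain A x"
    using assms by (rule gain_ge_card_nbrs)
  finally show ?thesis .
qed

text \<open>Ground the nodes of \<open>C\<close> one at a time. By supermodularity each gain is at
  most its value before any of them was grounded, and \<open>gain_ge_delta\<close> bounds it
  below.\<close>

lemma green_trace_diff_bounds:
  assumes "A \<subseteq> N" "C \<subseteq> A"
  shows "green_trace A - green_trace (A - C) \<le> (\<Sum>x\<in>C. gain A x)"
    and "real (card C) * (min_weight E r / real (n - 1)) \<le> green_trace A - green_trace (A - C)"
proof -
  define \<delta> where "\<delta> = min_weight E r / real (n - 1)"
  have "finite C"
    using assms finite_subset by (meson finite_atLeastAtMost)
  then have "green_trace A - green_trace (A - C) \<le> (\<Sum>x\<in>C. gain A x) \<and> real (card C) * \<delta> \<le> green_trace A - green_trace (A - C)"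
    using assms(2)
  proof (induction C rule: finite_induct)
    case (insert x C)
    have sub: "A - C \<subseteq> N" "x \<in> A - C"
      using insert assms(1) by auto
    have "green_trace (A - insert x C) = green_trace (A - C) - gain (A - C) x"
      using green_trace_remove[OF sub] by (metis Diff_insert)
    moreover have "gain (A - C) x \<le> gain A x"
      using sub assms(1) by (intro gain_mono) auto
    moreover have "\<delta> \<le> gain (A - C) x"
      unfolding \<delta>_def using sub by (rule gain_ge_delta)
    ultimately show ?case
      using insert by (simp add: distrib_right)
  qed simp
  then show "green_trace A - green_trace (A - C) \<le> (\<Sum>x\<in>C. gain A x)"
    "real (card C) * (min_weight E r / real (n - 1)) \<le> green_trace A - green_trace (A - C)"
    by (auto simp: \<delta>_def)
qed

text \<open>Average over the levels that \<open>B\<close> does not touch, with one node chosen in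
  each: a node can be adjacent to chosen nodes of three consecutive levels only, which bounds the
  sum of the neighbour counts.\<close>

lemma exists_low_degree:
  assumes B: "B \<subseteq> V" "1 \<in> B" "card B \<le> p" and i: "i \<in> V" "hop i = p"
  shows "\<exists>v\<in>V - B. card (nbrs v) * (p - (card B - 1)) \<le> 3 * (n - 1)"
proof -
  define q where "q = card B - 1"
  have finB: "finite B" using B finite_subset by blast
  have cB: "card B = Suc q"
  proof -
    have "0 < card B"
      using B(2) finB by (auto simp: card_gt_0_iff)
    then show ?thesis by (simp add: q_def)
  qed
  \<comment> \<open>Level 0 consists of node 1 alone, which lies in \<open>B\<close>. Levels
    therefore start at 1 and only \<open>q = card B - 1\<close> nodes can spoil one.\<close>
  define Lv where "Lv = {1..p} - hop ` (B - {1})"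
  have cL: "p - q \<le> card Lv"
  proof -
    have "card (hop ` (B - {1})) \<le> card (B - {1})"
      using finB by (intro card_image_le) auto
    also have "\<dots> = q"
      using B(2) finB cB by simp
    finally have "p - q \<le> card {1..p} - card (hop ` (B - {1}))"
      by simp
    also have "\<dots> \<le> card Lv"
      unfolding Lv_def by (rule diff_card_le_card_Diff) (use finB in auto)
    finally show ?thesis .
  qed
  have "\<exists>v\<in>V. hop v = l" if "l \<in> Lv" for l
  proof -
    have "l \<le> hop i"
      using that i(2) by (auto simp: Lv_def)
    then show ?thesis
      using hop_level[OF i(1)] by metis
  qed
  then obtain v where v: "\<And>l. l \<in> Lv \<Longrightarrow> v l \<in> V" "\<And>l. l \<in> Lv \<Longrightarrow> hop (v l) = l"
    by metis
  have vB: "v l \<in> V - B" "v l \<noteq> 1" if "l \<in> Lv" for l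
  proof -
    show "v l \<noteq> 1" using v(2)[OF that] that by (auto simp: Lv_def)
    moreover have "hop (v l) \<notin> hop ` (B - {1})"
      using v(2)[OF that] that by (simp add: Lv_def)
    ultimately show "v l \<in> V - B" using v(1)[OF that] by blast
  qed
  have finL: "finite Lv" by (simp add: Lv_def)
  define cnt where "cnt j = card {l\<in>Lv. j \<in> nbrs (v l)}" for j
  have level: "hop j \<le> Suc l" "l \<le> Suc (hop j)" "1 \<le> l" "j \<noteq> v l" if "l \<in> Lv" "j \<in> nbrs (v l)" for l j
    using hop_edge[of "v l" j] hop_edge[of j "v l"] v(2)[OF that(1)] that edge_in_V[of "v l" j]
    by (auto simp: nbrs_def insert_commute Lv_def)
  have cnt3: "cnt j \<le> 3" for j
  proof -
    have "cnt j \<le> card {hop j - 1, hop j, Suc (hop j)}"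
      unfolding cnt_def using level by (intro card_mono) fastforce+
    also have "\<dots> \<le> 3" by (simp add: card_insert_if)
    finally show ?thesis .
  qed
  have "Lv \<noteq> {}"
    using cL B(3) cB by auto
  then obtain l0 where l0: "l0 \<in> Lv" by auto
  \<comment> \<open>The factor \<open>n - 1\<close> comes from two exceptional nodes, 1 and
    \<open>v l0\<close>: \<open>1 + 2 + 3 * (n - 2) = 3 * (n - 1)\<close>.\<close>
  have cnt1: "cnt 1 \<le> 1"
  proof -
    have "cnt 1 \<le> card {1 :: nat}"
      unfolding cnt_def using level[where j = 1] by (intro card_mono) fastforce+
    then show ?thesis by simp
  qed
  have cnt2: "cnt (v l0) \<le> 2"
  proof -
    have "l \<noteq> l0" if "l \<in> Lv" "v l0 \<in> nbrs (v l)" for l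
      using level(4)[OF that] by auto
    then have "cnt (v l0) \<le> card {l0 - 1, Suc l0}"
      unfolding cnt_def using level[where j = "v l0"] v(2)[OF l0] by (intro card_mono) fastforce+
    also have "\<dots> \<le> 2" by (simp add: card_insert_if)
    finally show ?thesis .
  qed
  have "(\<Sum>l\<in>Lv. card (nbrs (v l))) = (\<Sum>l\<in>Lv. \<Sum>j\<in>V. if j \<in> nbrs (v l) then 1 else 0)"
    by (intro sum.cong) (auto simp: sum.If_cases nbrs_def Int_def)
  also have "\<dots> = (\<Sum>j\<in>V. \<Sum>l\<in>Lv. if j \<in> nbrs (v l) then 1 else 0)"
    by (rule sum.swap)
  also have "\<dots> = (\<Sum>j\<in>V. cnt j)"
    using finL by (intro sum.cong) (auto simp: cnt_def sum.If_cases Int_def)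
  also have "V = insert 1 (insert (v l0) (V - {1, v l0}))"
    using vB[OF l0] n_ge_1 by auto
  also have "(\<Sum>j\<in>insert 1 (insert (v l0) (V - {1, v l0})). cnt j)
      = cnt 1 + (cnt (v l0) + (\<Sum>j\<in>V - {1, v l0}. cnt j))"
    using vB[OF l0] by simp
  also have "(\<Sum>j\<in>V - {1, v l0}. cnt j) \<le> (\<Sum>j\<in>V - {1, v l0}. 3)"
    by (intro sum_mono cnt3)
  also have "(\<Sum>j\<in>V - {1, v l0}. 3 :: nat) = 3 * (n - 2)"
    using vB[OF l0] n_ge_1 by (simp add: card_Diff_subset)
  finally have total: "(\<Sum>l\<in>Lv. card (nbrs (v l))) \<le> 3 * (n - 1)"
    using cnt1 cnt2 vB[OF l0] by auto
  show ?thesis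
  proof (rule ccontr)
    assume "\<not> ?thesis"
    then have gt: "3 * (n - 1) < card (nbrs (v l)) * (p - q)" if "l \<in> Lv" for l
      using vB(1)[OF that] by (auto simp: q_def not_le)
    have "card Lv * (3 * (n - 1)) < (\<Sum>l\<in>Lv. card (nbrs (v l)) * (p - q))"
      using sum_strict_mono[OF finL \<open>Lv \<noteq> {}\<close> gt] by simp
    also have "\<dots> = (\<Sum>l\<in>Lv. card (nbrs (v l))) * (p - q)"
      by (simp add: sum_distrib_right)
    also have "\<dots> \<le> 3 * (n - 1) * card Lv"
      using total cL by (intro mult_mono) auto
    finally show False by (simp add: mult.commute)
  qed
qed

lemma green_trace_N_le:
  assumes "\<And>i. i \<in> V \<Longrightarrow> hop i \<le> p" "2 \<le> n"
  shows "green_trace N \<le> real (n - 1) * real p * max_weight E r"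
proof -
  have "green_trace N = (\<Sum>i\<in>N. green_fun N i i)"
    unfolding green_trace_def by (intro sum.mono_neutral_right) (auto simp: green_fun_zero[of N])
  also have "\<dots> \<le> (\<Sum>i\<in>N. real p * max_weight E r)"
  proof (rule sum_mono)
    fix i assume "i \<in> N"
    then have i: "i \<in> V" by auto
    have "green_fun N i i \<le> real (hop i) * max_weight E r"
      using i by (rule green_fun_le_hop)
    also have "\<dots> \<le> real p * max_weight E r"
      using assms(1)[OF i] weights_pos[OF assms(2)] by (intro mult_right_mono) auto
    finally show "green_fun N i i \<le> real p * max_weight E r" .
  qed
  also have "\<dots> = real (n - 1) * real p * max_weight E r"
    by simp
  finally show ?thesis .
qed

lemma green_trace_empty [simp]: "green_trace {} = 0"
  by (simp add: green_trace_def green_fun_zero[of "{}"])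

lemma feasible_V: "0 < \<alpha> \<Longrightarrow> feasible n E r \<alpha> V"
  using n_ge_1 err_eq[of V] by (simp add: feasible_def)

lemma opt_size_witness:
  assumes "0 < \<alpha>"
  obtains S where "feasible n E r \<alpha> S" "card S = opt_size n E r \<alpha>"
proof -
  have "finite {S. feasible n E r \<alpha> S}"
    by (rule finite_subset[of _ "Pow V"]) (auto simp: feasible_def)
  then have "opt_size n E r \<alpha> \<in> card ` {S. feasible n E r \<alpha> S}"
    unfolding opt_size_def using feasible_V[OF assms] by (intro Min_in) auto
  then show ?thesis using that by auto
qed

text \<open>The sequence \<open>a\<close>, which is \<open>n\<close> times the excess of the error
  over \<alpha>, is shown to satisfy the hypotheses of \<open>greedy_steps_bound\<close>.\<close>

lemma greedy_cover_size:
  assumes s0: "s 0 = {1}" and \<alpha>: "0 < \<alpha>"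
    and above: "\<And>t. t < T \<Longrightarrow> \<alpha> < err n E r (s t)"
    and grow: "\<And>t. t < T \<Longrightarrow> \<exists>x. x \<in> V - s t \<and> s (Suc t) = insert x (s t)"
    and best: "\<And>t y. t < T \<Longrightarrow> y \<in> V - s t \<Longrightarrow> err n E r (s (Suc t)) \<le> err n E r (insert y (s t))"
    and S: "feasible n E r \<alpha> S"
  shows "real (card (s T)) \<le>
    (1 + ln ((real n - 1)\<^sup>2 * (max_weight E r / min_weight E r))) * real (card S)"
proof -
  have sub: "1 \<in> s t \<and> s t \<subseteq> V \<and> card (s t) = Suc t" if "t \<le> T" for t
    using that
  proof (induction t)
    case 0
    then show ?case using s0 n_ge_1 by simp
  next
    case (Suc t)
    then obtain x where "x \<in> V - s t" "s (Suc t) = insert x (s t)"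
      using grow[of t] by auto
    then show ?case
      using Suc finite_subset[of "s t" V] by auto
  qed
  have mono: "s t \<subseteq> s u" if "t \<le> u" "u \<le> T" for t u
    using that
  proof (induction u)
    case (Suc u)
    then show ?case
      using grow[of u] by (cases "t = Suc u") force+
  qed simp
  have S': "1 \<in> S" "S \<subseteq> V" "err n E r S \<le> \<alpha>" "finite S"
    using S finite_subset[of S V] by (auto simp: feasible_def)
  then have cS: "card S = Suc (card S - 1)"
    by (metis Suc_diff_1 card_gt_0_iff empty_iff)
  \<comment> \<open>Node 1 lies in every greedy set, so at most \<open>k\<close> nodes of
    \<open>S\<close> are ever missing.\<close>
  define k where "k = card S - 1"
  show ?thesis
  proof (cases "n = 1")
    case True
    then have "T = 0"
      using sub[of T] card_mono[of V "s T"] by simp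
    \<comment> \<open>For \<open>n = 1\<close> the argument of \<open>ln\<close> is 0 and
      \<open>ln 0 = 0\<close>; the claim becomes \<open>1 \<le> card S\<close>.\<close>
    then show ?thesis
      using s0 cS True by simp
  next
    case False
    then have n2: "2 \<le> n" using n_ge_1 by simp
    define m where "m = n - 1"
    have m: "real m = real n - 1" using n2 by (simp add: m_def)
    define p where "p = Max (hop ` V)"
    have p: "hop i \<le> p" if "i \<in> V" for i
      using that by (simp add: p_def)
    have "p \<in> hop ` V"
      unfolding p_def using n_ge_1 by (intro Max_in) auto
    then obtain far where far: "far \<in> V" "hop far = p" by auto
    define a where "a t = green_trace (V - s t) - real n * \<alpha>" for t
    have UN: "V - s t \<subseteq> N" if "t \<le> T" for t
      using sub[OF that] by (auto simp: Suc_le_eq le_less)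
    have err: "err n E r (s t) = green_trace (V - s t) / real n" if "t \<le> T" for t
      using sub[OF that] by (intro err_eq) auto
    have gain_le: "gain (V - s t) y \<le> a t - a (Suc t)" if "t < T" "y \<in> V - s t" for t y
    proof -
      note y = that(2)
      have "err n E r (insert y (s t)) = green_trace (V - s t - {y}) / real n"
      proof -
        have "V - insert y (s t) = V - s t - {y}" by blast
        moreover have "err n E r (insert y (s t)) = green_trace (V - insert y (s t)) / real n"
          using sub[of t] that(1) y by (intro err_eq) auto
        ultimately show ?thesis by (simp only:)
      qed
      then have "green_trace (V - s (Suc t)) \<le> green_trace (V - s t - {y})"
        using best[OF that] err[of "Suc t"] that n2 by (simp add: divide_le_cancel)
      then show ?thesis
        using green_trace_remove[OF UN that(2)] that(1) by (simp add: a_def)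
    qed
    let ?\<delta> = "min_weight E r / real m"
    have \<delta>0: "0 \<le> ?\<delta>" using weights_pos[OF n2] by simp
    \<comment> \<open>The union of \<open>S\<close> and \<open>s t\<close> is compared with both
      sets: reaching it from \<open>s t\<close> takes at most \<open>k\<close> nodes, none better
      than the greedy one, and reaching it from \<open>S\<close> gains at least
      \<open>?\<delta>\<close> per added node.\<close>
    have progress: "a t + real (card (s t - S)) * ?\<delta> \<le> real k * (a t - a (Suc t))" if t: "t < T" for t
    proof -
      have tT: "t \<le> T" using t by simp
      let ?C = "S - s t"
      have C: "?C \<subseteq> V - s t" using S' by auto
      have cC: "card ?C \<le> k"
      proof -
        have "card ?C \<le> card (S - {1})"
          using S' sub[OF tT] by (intro card_mono) auto
        then show ?thesis using S' by (simp add: k_def)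
      qed
      have nonneg: "0 \<le> a t - a (Suc t)"
      proof -
        obtain x where x: "x \<in> V - s t" using grow[OF t] by auto
        have "0 \<le> gain (V - s t) x"
          using gain_ge_delta[OF UN[OF tT] x] \<delta>0 by (simp add: m_def)
        then show ?thesis using gain_le[OF t x] by linarith
      qed
      have "green_trace (V - s t) - green_trace (V - s t - ?C) \<le> (\<Sum>x\<in>?C. gain (V - s t) x)"
        by (rule green_trace_diff_bounds[OF UN[OF tT] C])
      also have "\<dots> \<le> (\<Sum>x\<in>?C. a t - a (Suc t))"
        using C gain_le[OF t] by (intro sum_mono) auto
      also have "\<dots> \<le> real k * (a t - a (Suc t))"
        using cC nonneg by (simp add: mult_right_mono)
      finally have 1: "green_trace (V - s t) - green_trace (V - s t - ?C) \<le> real k * (a t - a (Suc t))" .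
      have VS: "V - S \<subseteq> N"
        using S' by (auto simp: Suc_le_eq le_less)
      have "real (card (s t - S)) * ?\<delta> \<le> green_trace (V - S) - green_trace (V - S - (s t - S))"
        unfolding m_def using sub[OF tT] by (intro green_trace_diff_bounds(2)[OF VS]) auto
      moreover have "V - S - (s t - S) = V - s t - ?C"
        by auto
      moreover have "green_trace (V - S) \<le> real n * \<alpha>"
        using S' err_eq[of S] n2 by (simp add: field_simps)
      ultimately show ?thesis
        using 1 by (simp add: a_def)
    qed
    have "real T + 1 \<le> (1 + ln ((real m)\<^sup>2 * (max_weight E r / min_weight E r))) * (real k + 1)"
    proof (rule greedy_steps_bound[where a = a and p = p])
      show "0 < a t" if "t < T" for t
        using above[OF that] err[of t] that n2 by (simp add: a_def field_simps)
      show "0 < min_weight E r" "min_weight E r \<le> max_weight E r"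
        using weights_pos[OF n2] by auto
      show "T \<le> m"
        using sub[of T] card_mono[of V "s T"] by (simp add: m_def)
      show "a t \<le> real k * (a t - a (Suc t))" if "t < T" for t
        using progress[OF that] mult_nonneg_nonneg[OF of_nat_0_le_iff[of "card (s t - S)"] \<delta>0]
        by linarith
      show "a t + (real t - real k) * ?\<delta> \<le> real k * (a t - a (Suc t))" if "t < T" for t
      proof -
        have "card (s t) - card S \<le> card (s t - S)"
          using S' by (intro diff_card_le_card_Diff) auto
        then have "real t - real k \<le> real (card (s t - S))"
          using sub[of t] that cS by (simp add: k_def)
        then have "(real t - real k) * ?\<delta> \<le> real (card (s t - S)) * ?\<delta>"
          using \<delta>0 by (rule mult_right_mono)
        then show ?thesis using progress[OF that] by linarith
      qed
      have "V - {1} = N" by auto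
      then have "a 0 \<le> green_trace N"
        using \<alpha> s0 by (simp add: a_def)
      then show "a 0 \<le> real m * real p * max_weight E r"
        using green_trace_N_le[OF p n2] by (simp add: m_def)
      \<comment> \<open>The node with few neighbours is taken outside the last set
        \<open>s (T - 1)\<close>, hence outside \<open>s t\<close> as well, so the greedy step at
        \<open>t\<close> does at least as well as adding it.\<close>
      show "min_weight E r * (real p - (real T - 1)) / (3 * real m) \<le> a t - a (Suc t)"
        if t: "t < T" "T \<le> p" for t
      proof -
        have last: "1 \<in> s (T - 1)" "s (T - 1) \<subseteq> V" "card (s (T - 1)) = T"
          using sub[of "T - 1"] t by auto
        obtain v where v: "v \<in> V - s (T - 1)" "card (nbrs v) * (p - (T - 1)) \<le> 3 * m"
          using exists_low_degree[OF last(2,1) _ far] last(3) t by (auto simp: m_def)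
        have vt: "v \<in> V - s t"
        proof -
          have "s t \<subseteq> s (T - 1)"
            using t by (intro mono) auto
          then show ?thesis using v(1) by blast
        qed
        have vN: "v \<in> N" using vt UN[of t] t by auto
        have "real (card (nbrs v)) * (real p - (real T - 1)) = real (card (nbrs v) * (p - (T - 1)))"
          using t by (simp add: of_nat_diff)
        also have "\<dots> \<le> 3 * real m"
          using v(2) by (metis of_nat_le_iff of_nat_mult of_nat_numeral)
        finally have "real (card (nbrs v)) * (real p - (real T - 1)) \<le> 3 * real m" .
        then have "(real p - (real T - 1)) / (3 * real m) \<le> 1 / real (card (nbrs v))"
          using card_nbrs_pos[OF vN] n2 m by (simp add: field_simps)
        then have "min_weight E r * ((real p - (real T - 1)) / (3 * real m))
            \<le> min_weight E r * (1 / real (card (nbrs v)))"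
          using weights_pos[OF n2] by (intro mult_left_mono) auto
        also have "\<dots> \<le> gain (V - s t) v"
          using gain_ge_card_nbrs[OF UN vt] t by simp
        also have "\<dots> \<le> a t - a (Suc t)"
          by (rule gain_le[OF t(1) vt])
        finally show ?thesis by simp
      qed
    qed
    then show ?thesis
      using sub[of T] cS m by (simp add: k_def)
  qed
qed

end

theorem theorem11:
  fixes n :: nat and E :: "nat set set" and r :: "nat \<Rightarrow> nat \<Rightarrow> real" and \<alpha> :: real
  assumes "weighted_graph n E r"
    and "\<alpha> > 0"
  shows "feasible n E r \<alpha> (run (err n E r) (greedy_cover n \<alpha>)) \<and>
         real (card (run (err n E r) (greedy_cover n \<alpha>)))
           \<le> (1 + ln ((real n - 1)\<^sup>2 * (max_weight E r / min_weight E r)))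
             * real (opt_size n E r \<alpha>) \<and>
         queries (err n E r) (greedy_cover n \<alpha>) \<le> n\<^sup>2"
proof -
  interpret network n E r
    by unfold_locales (rule assms(1))
  let ?f = "err n E r"
  obtain s T where s: "s 0 = {1}" "s T = run ?f (greedy_cover n \<alpha>)"
    "\<And>t. t < T \<Longrightarrow> \<alpha> < ?f (s t)"
    "\<And>t. t < T \<Longrightarrow> \<exists>x. x \<in> {1..n} - s t \<and> s (Suc t) = insert x (s t)"
    "\<And>t y. t < T \<Longrightarrow> y \<in> {1..n} - s t \<Longrightarrow> ?f (s (Suc t)) \<le> ?f (insert y (s t))"
    "?f (s T) \<le> \<alpha> \<or> s T = {1..n}"
    "queries ?f (greedy_cover n \<alpha>) \<le> n\<^sup>2"
    using greedy_cover_trace[OF n_ge_1, of ?f \<alpha>] by blast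
  obtain S where S: "feasible n E r \<alpha> S" "card S = opt_size n E r \<alpha>"
    using opt_size_witness[OF assms(2)] by blast
  have "1 \<in> s t \<and> s t \<subseteq> {1..n}" if "t \<le> T" for t
    using that
  proof (induction t)
    case 0
    then show ?case using s(1) n_ge_1 by simp
  next
    case (Suc t)
    then show ?case using s(4)[of t] by auto
  qed
  \<comment> \<open>If the chain ends by exhausting the nodes, its last set is the full one, whose
    error is 0.\<close>
  then have "feasible n E r \<alpha> (s T)"
    using s(6) feasible_V[OF assms(2)] by (auto simp: feasible_def)
  moreover have "real (card (s T)) \<le>
      (1 + ln ((real n - 1)\<^sup>2 * (max_weight E r / min_weight E r))) * real (card S)"
    using s(1) assms(2) s(3-5) S(1) by (rule greedy_cover_size)
  ultimately show ?thesis
    using s(2,7) S(2) by simp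
qed

end
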